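(* Let $\mathbb{T}^2$ denote the $7$-vertex triangulated torus with a fixed orientation. For every integer $d$, there exists a minimal degree $d$ simplicial map from a triangulated (oriented) torus to $\mathbb{T}^2$, and there exists a minimal degree $d$ simplicial map from a triangulated (oriented) closed orientable surface of genus $2$ to $\mathbb{T}^2$.
   Context: A triangulation of a surface $M$ is a finite (abstract or geometric) simplicial complex whose geometric carrier is homeomorphic to $M$. A simplicial map $f:K\to L$ is a map of vertex sets sending the vertices of every simplex of $K$ to the vertices of a simplex of $L$ (possibly of lower dimension). The $7$-vertex triangulated torus $\mathbb{T}^2$ is the simplicial complex on vertices $v_1,\dots,v_7$ with the $14$ triangles $[v_1v_2v_4]$, $[v_2v_4v_5]$, $[v_2v_3v_5]$, $[v_3v_5v_6]$, $[v_1v_5v_6]$, $[v_1v_2v_6]$, $[v_2v_6v_7]$, $[v_2v_3v_7]$, $[v_1v_3v_7]$, $[v_1v_5v_7]$, $[v_4v_5v_7]$, $[v_4v_6v_7]$, $[v_3v_4v_6]$, $[v_1v_3v_4]$; it is oriented so that $[v_1v_2v_4]$, with vertex order $v_1<v_2<v_4$, is positively oriented. For closed connected oriented triangulated surfaces $K,L$ with fundamental classes $[a]\in H_2(K;\mathbb{Z})\cong\mathbb{Z}$ and $[b]\in H_2(L;\mathbb{Z})\cong\mathbb{Z}$, the degree of a simplicial map $f:K\to L$ is the integer $d$ with $f_*([a])=d\cdot[b]$. The orientation of the domain $K$ may be chosen freely (so reversing it changes $d$ to $-d$). A degree $d$ simplicial map $f:K\to\mathbb{T}^2$ from a triangulation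 $K$ of the genus $g$ closed orientable surface is called minimal if $K$ has the least number of vertices among all triangulations of the genus $g$ closed orientable surface that (for some orientation) admit a degree $d$ simplicial map to $\mathbb{T}^2$. *)

theory Defs
  imports "HOL-Analysis.Analysis"
begin

section \<open>Simplicial complexes and simplicial maps\<close>

definition simplicial_complex :: "'v set set \<Rightarrow> bool" where
  "simplicial_complex K \<longleftrightarrow>
     finite K \<and> (\<forall>s\<in>K. finite s \<and> s \<noteq> {}) \<and> (\<forall>s\<in>K. \<forall>t. t \<subseteq> s \<and> t \<noteq> {} \<longrightarrow> t \<in> K)"

abbreviation vertices :: "'v set set \<Rightarrow> 'v set" where
  "vertices K \<equiv> \<Union>K"

text \<open>Only the values of \<open>f\<close> on the vertices of \<open>K\<close> matter, here and in \<open>push_chain\<close> below.\<close>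

definition simplicial_map :: "'v set set \<Rightarrow> 'w set set \<Rightarrow> ('v \<Rightarrow> 'w) \<Rightarrow> bool" where
  "simplicial_map K L f \<longleftrightarrow> (\<forall>s\<in>K. f ` s \<in> L)"

text \<open>The points of the geometric carrier are given by their barycentric coordinates. It carries the
  subspace topology of the product topology on functions, which for a finite complex is the
  Euclidean one.\<close>

definition geometric_carrier :: "'v set set \<Rightarrow> ('v \<Rightarrow> real) set" where
  "geometric_carrier K =
     {x. (\<forall>v. 0 \<le> x v) \<and> {v. x v \<noteq> 0} \<in> K \<and> (\<Sum>v | x v \<noteq> 0. x v) = 1}"


section \<open>Closed orientable surfaces\<close>

definition torus_space :: "(complex \<times> complex) topology" where
  "torus_space = prod_topology (top_of_set (sphere 0 1)) (top_of_set (sphere 0 1))"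

text \<open>\<open>X\<close> is a connected sum of \<open>A\<close> and \<open>B\<close>: the interiors of closed discs embedded
  (via \<open>e\<close> and \<open>e'\<close>) in \<open>A\<close> and \<open>B\<close> are removed and what remains is glued along
  the boundary circles. The maps \<open>p\<close> and \<open>q\<close> embed the two pieces as a closed cover of
  \<open>X\<close>, so \<open>X\<close> is the adjunction space. No orientation condition is imposed on the gluing:
  for the surfaces below it does not affect the result, since all of them have
  orientation-reversing self-homeomorphisms.\<close>

definition connected_sum :: "'a topology \<Rightarrow> 'b topology \<Rightarrow> 'c topology \<Rightarrow> bool" where
  "connected_sum A B X \<longleftrightarrow>
     (\<exists>e e' p q.
        embedding_map (top_of_set (cball (0::complex) 1)) A e \<and>
        embedding_map (top_of_set (cball (0::complex) 1)) B e' \<and>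
        (let A' = topspace A - e ` ball 0 1; B' = topspace B - e' ` ball 0 1 in
           embedding_map (subtopology A A') X p \<and> closedin X (p ` A') \<and>
           embedding_map (subtopology B B') X q \<and> closedin X (q ` B') \<and>
           p ` A' \<union> q ` B' = topspace X \<and>
           p ` A' \<inter> q ` B' = p ` e ` sphere 0 1 \<and>
           (\<forall>z\<in>sphere 0 1. p (e z) = q (e' z))))"

fun genus_surface :: "nat \<Rightarrow> 'a topology \<Rightarrow> bool" where
  "genus_surface 0 X \<longleftrightarrow> X homeomorphic_space nsphere 2"
| "genus_surface (Suc 0) X \<longleftrightarrow> X homeomorphic_space torus_space"
| "genus_surface (Suc (Suc g)) X \<longleftrightarrow>
     (\<exists>Y :: 'a topology. genus_surface (Suc g) Y \<and> connected_sum Y torus_space X)"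

definition triangulated_genus_surface :: "nat \<Rightarrow> 'v set set \<Rightarrow> bool" where
  "triangulated_genus_surface g K \<longleftrightarrow>
     simplicial_complex K \<and> genus_surface g (top_of_set (geometric_carrier K))"


section \<open>Simplicial homology with integer coefficients\<close>

text \<open>A \<open>p\<close>-chain is an integer-valued function on ordered \<open>p\<close>-simplices that changes sign
  under odd permutations of the vertices (adjacent transpositions suffice). The value \<open>c xs\<close>
  is the coefficient in \<open>c\<close> of the oriented simplex \<open>xs\<close>.\<close>

definition chains :: "nat \<Rightarrow> 'v set set \<Rightarrow> ('v list \<Rightarrow> int) set" where
  "chains p K =
     {c. (\<forall>xs. c xs \<noteq> 0 \<longrightarrow> length xs = Suc p \<and> distinct xs \<and> set xs \<in> K) \<and>
         (\<forall>xs y z zs. c (xs @ y # z # zs) = - c (xs @ z # y # zs))}"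

text \<open>The usual boundary \<open>\<partial>[x\<^sub>0,\<dots>,x\<^sub>p] = \<Sum>\<^sub>i (-1)^i [x\<^sub>0,\<dots>,x\<^sub>i\<^sub>-\<^sub>1,x\<^sub>i\<^sub>+\<^sub>1,\<dots>,x\<^sub>p]\<close>, read off
  coefficientwise: \<open>xs\<close> has coefficient 1 in the boundary of \<open>w # xs\<close>.\<close>

definition boundary :: "'v set set \<Rightarrow> ('v list \<Rightarrow> int) \<Rightarrow> 'v list \<Rightarrow> int" where
  "boundary K c xs = (\<Sum>w\<in>vertices K. c (w # xs))"

definition cycles :: "nat \<Rightarrow> 'v set set \<Rightarrow> ('v list \<Rightarrow> int) set" where
  "cycles p K = {c \<in> chains p K. \<forall>xs. boundary K c xs = 0}"

definition homologous :: "nat \<Rightarrow> 'v set set \<Rightarrow> ('v list \<Rightarrow> int) \<Rightarrow> ('v list \<Rightarrow> int) \<Rightarrow> bool" where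
  "homologous p K c c' \<longleftrightarrow> (\<lambda>xs. c xs - c' xs) \<in> boundary K ` chains (Suc p) K"

text \<open>The induced chain map sends \<open>[x\<^sub>0,\<dots>,x\<^sub>p]\<close> to \<open>[f x\<^sub>0,\<dots>,f x\<^sub>p]\<close> if these vertices are
  distinct and to 0 otherwise.\<close>

definition push_chain ::
    "'v set set \<Rightarrow> ('v \<Rightarrow> 'w) \<Rightarrow> ('v list \<Rightarrow> int) \<Rightarrow> 'w list \<Rightarrow> int" where
  "push_chain K f c ys =
     (if distinct ys then \<Sum>xs | set xs \<subseteq> vertices K \<and> map f xs = ys. c xs else 0)"

text \<open>The class of \<open>a\<close> freely generates \<open>H\<^sub>2(K; \<int>)\<close>, i.e. it is a fundamental class and hence
  an orientation of the closed connected orientable surface triangulated by \<open>K\<close>.\<close>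

definition fundamental_cycle :: "'v set set \<Rightarrow> ('v list \<Rightarrow> int) \<Rightarrow> bool" where
  "fundamental_cycle K a \<longleftrightarrow>
     a \<in> cycles 2 K \<and> (\<forall>z\<in>cycles 2 K. \<exists>!k. homologous 2 K z (\<lambda>xs. k * a xs))"

definition has_degree ::
    "'v set set \<Rightarrow> ('v list \<Rightarrow> int) \<Rightarrow> 'w set set \<Rightarrow> ('w list \<Rightarrow> int) \<Rightarrow> ('v \<Rightarrow> 'w) \<Rightarrow> int \<Rightarrow> bool" where
  "has_degree K a L b f d \<longleftrightarrow> homologous 2 L (push_chain K f a) (\<lambda>ys. d * b ys)"


section \<open>Degree \<open>d\<close> maps to the 7-vertex torus\<close>

text \<open>The vertex \<open>v\<^sub>i\<close> is represented by the number \<open>i\<close>.\<close>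

definition torus7_triangles :: "nat set set" where
  "torus7_triangles =
     {{1,2,4}, {2,4,5}, {2,3,5}, {3,5,6}, {1,5,6}, {1,2,6}, {2,6,7},
      {2,3,7}, {1,3,7}, {1,5,7}, {4,5,7}, {4,6,7}, {3,4,6}, {1,3,4}}"

definition torus7 :: "nat set set" where
  "torus7 = {s. s \<noteq> {} \<and> (\<exists>t\<in>torus7_triangles. s \<subseteq> t)}"

definition torus7_orientation :: "(nat list \<Rightarrow> int) \<Rightarrow> bool" where
  "torus7_orientation b \<longleftrightarrow> fundamental_cycle torus7 b \<and> b [1,2,4] = 1"

definition degree_map_to_torus7 ::
    "nat \<Rightarrow> (nat list \<Rightarrow> int) \<Rightarrow> int \<Rightarrow>
     nat set set \<Rightarrow> (nat list \<Rightarrow> int) \<Rightarrow> (nat \<Rightarrow> nat) \<Rightarrow> bool" where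
  "degree_map_to_torus7 g b d K a f \<longleftrightarrow>
     triangulated_genus_surface g K \<and> fundamental_cycle K a \<and>
     simplicial_map K torus7 f \<and> has_degree K a torus7 b f d"

text \<open>Minimality ranges over all complexes with vertices in \<open>nat\<close>; every finite complex is
  isomorphic to one of these.\<close>

definition minimal_degree_map_to_torus7 ::
    "nat \<Rightarrow> (nat list \<Rightarrow> int) \<Rightarrow> int \<Rightarrow>
     nat set set \<Rightarrow> (nat list \<Rightarrow> int) \<Rightarrow> (nat \<Rightarrow> nat) \<Rightarrow> bool" where
  "minimal_degree_map_to_torus7 g b d K a f \<longleftrightarrow>
     degree_map_to_torus7 g b d K a f \<and>
     (\<forall>K' a' f'. degree_map_to_torus7 g b d K' a' f' \<longrightarrow>
        card (vertices K) \<le> card (vertices K'))"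

end

theory Submission
  imports Defs
begin

text \<open>Numbers of vertices are natural numbers, so a minimal map of a given degree exists as soon as
  any map of that degree exists. The work is therefore a construction, for every degree and for genus
  1 and 2.

  The 7-vertex torus is cyclic: its triangles are the translates \<open>{i, i+1, i+3}\<close> and
  \<open>{i, i+2, i+3}\<close> modulo 7. The same triangles modulo \<open>n\<close>, for any
  \<open>n \<ge> 7\<close>, again triangulate a torus, namely the quotient of the triangular
  lattice (whose point \<open>(p, q)\<close> carries the label \<open>p + 2 q\<close>) by the
  translations that preserve labels modulo \<open>n\<close>; this is
  \<open>cyclic_labelling.carrier_homeomorphic_torus\<close>. For \<open>n = 7 d\<close> with
  \<open>d > 0\<close>, reduction of the labels modulo 7 is a \<open>d\<close>-fold covering of the
  7-vertex torus, hence a simplicial map of degree \<open>d\<close>. Reversing the orientation of the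
  domain gives degree \<open>- d\<close>, and a constant map gives degree 0.

  For genus 2, the triangle \<open>{2, 3, 5}\<close> is removed from the cyclic torus on \<open>7 d\<close>
  vertices and from a second cyclic torus on 7 vertices, and the two are glued along its boundary.
  All vertices of the second torus off the seam are sent to 2, so the second torus lands inside the
  single triangle \<open>{2, 3, 5}\<close> of the target.

  The degree is read off at one triangle. A fundamental cycle of the target generates all 2-cycles,
  so the push-forward of an orientation is \<open>k\<close> times the orientation of the target, and
  \<open>k\<close> is the signed number of triangles lying over \<open>[1, 2, 4]\<close>
  (\<open>degree_eq_push_chain\<close>). This triangle differs from \<open>{2, 3, 5}\<close>, so the
  gluing does not affect the count.

  Both kinds of domain are handled through a ternary relation listing the positively oriented
  triangles (\<open>oriented_pseudomanifold\<close>): local conditions at the edges together with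
  connectedness across edges make the signed sum of the triangles a fundamental cycle, and these
  conditions survive the gluing.\<close>

section \<open>Push-forward of two-dimensional cycles\<close>

lemma chainsI:
  assumes "\<And>xs. c xs \<noteq> 0 \<Longrightarrow> length xs = Suc p \<and> distinct xs \<and> set xs \<in> K"
    and "\<And>xs y z zs. c (xs @ y # z # zs) = - c (xs @ z # y # zs)"
  shows "c \<in> chains p K"
  using assms unfolding chains_def by blast

lemma chains_support:
  "c \<in> chains p K \<Longrightarrow> c xs \<noteq> 0 \<Longrightarrow> length xs = Suc p \<and> distinct xs \<and> set xs \<in> K"
  unfolding chains_def by blast

lemma chains_swap: "c \<in> chains p K \<Longrightarrow> c (xs @ y # z # zs) = - c (xs @ z # y # zs)"
  unfolding chains_def by blast

text \<open>A complex of dimension at most 2 has no 3-chains to bound, so homology classes of 2-cycles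
  are single cycles.\<close>

lemma homologous_2_iff_eq:
  assumes "\<And>s. s \<in> K \<Longrightarrow> card s \<le> 3"
  shows "homologous 2 K c c' \<longleftrightarrow> c = c'"
proof -
  have "chains (Suc 2) K = {\<lambda>_. 0}"
  proof (rule set_eqI, rule iffI)
    fix c :: "'a list \<Rightarrow> int" assume c: "c \<in> chains (Suc 2) K"
    have "c xs = 0" for xs
    proof (rule ccontr)
      assume "c xs \<noteq> 0"
      then have "length xs = 4" "distinct xs" "set xs \<in> K"
        using chains_support[OF c] by auto
      then show False using assms[of "set xs"] distinct_card[of xs] by simp
    qed
    then show "c \<in> {\<lambda>_. 0}" by auto
  qed (simp add: chains_def)
  then show ?thesis
    unfolding homologous_def by (auto simp: boundary_def fun_eq_iff)
qed

lemma fundamental_cycle_uminus: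
  assumes "fundamental_cycle K a"
  shows "fundamental_cycle K (\<lambda>xs. - a xs)"
proof -
  have "(\<lambda>xs. - a xs) \<in> cycles 2 K"
  proof -
    have a: "a \<in> chains 2 K" "\<And>xs. boundary K a xs = 0"
      using assms unfolding fundamental_cycle_def cycles_def by auto
    have "(\<lambda>xs. - a xs) \<in> chains 2 K"
    proof (rule chainsI)
      fix xs assume "- a xs \<noteq> 0"
      then show "length xs = Suc 2 \<and> distinct xs \<and> set xs \<in> K"
        using chains_support[OF a(1)] by simp
    next
      fix xs y z zs show "- a (xs @ y # z # zs) = - (- a (xs @ z # y # zs))"
        unfolding chains_swap[OF a(1), of xs y z zs] ..
    qed
    then show ?thesis
      using a(2) unfolding cycles_def boundary_def by (simp add: sum_negf)
  qed
  moreover have "\<exists>!k. homologous 2 K z (\<lambda>xs. k * - a xs)" if "z \<in> cycles 2 K" for z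
  proof -
    have ex: "\<exists>!k. homologous 2 K z (\<lambda>xs. k * a xs)"
      using assms that unfolding fundamental_cycle_def by blast
    then obtain k where k: "homologous 2 K z (\<lambda>xs. k * a xs)" by blast
    show ?thesis
    proof (rule ex1I[of _ "- k"])
      fix k' assume "homologous 2 K z (\<lambda>xs. k' * - a xs)"
      then have "homologous 2 K z (\<lambda>xs. (- k') * a xs)" by simp
      then show "k' = - k" using ex k by fastforce
    qed (use k in simp)
  qed
  ultimately show ?thesis unfolding fundamental_cycle_def by blast
qed

lemma push_chain_uminus: "push_chain K f (\<lambda>xs. - a xs) ys = - push_chain K f a ys"
  unfolding push_chain_def by (simp add: sum_negf)

lemma chain_swap_triple:
  assumes "c \<in> chains p K"
  shows "c [y, x, z] = - c [x, y, z]" "c [x, z, y] = - c [x, y, z]"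
  using chains_swap[OF assms, of "[]" y x "[z]"] chains_swap[OF assms, of "[x]" z y "[]"]
  by simp_all

definition fibre_sum :: "'v set set \<Rightarrow> ('v \<Rightarrow> 'w) \<Rightarrow> ('v list \<Rightarrow> int) \<Rightarrow> 'w \<Rightarrow> 'w \<Rightarrow> 'w \<Rightarrow> int" where
  "fibre_sum K f c u v w =
     (\<Sum>x | x \<in> vertices K \<and> f x = u. \<Sum>y | y \<in> vertices K \<and> f y = v.
        \<Sum>z | z \<in> vertices K \<and> f z = w. c [x, y, z])"

lemma fibre_sum_swap:
  assumes c: "c \<in> chains 2 K"
  shows "fibre_sum K f c v u w = - fibre_sum K f c u v w"
    and "fibre_sum K f c u w v = - fibre_sum K f c u v w"
proof -
  have "fibre_sum K f c v u w = (\<Sum>x | x \<in> vertices K \<and> f x = v. \<Sum>y | y \<in> vertices K \<and> f y = u.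
      - (\<Sum>z | z \<in> vertices K \<and> f z = w. c [y, x, z]))"
    unfolding fibre_sum_def sum_negf[symmetric] by (intro sum.cong refl) (rule chain_swap_triple(1)[OF c])
  also have "\<dots> = - fibre_sum K f c u v w"
    unfolding fibre_sum_def sum_negf by (subst sum.swap) (rule refl)
  finally show "fibre_sum K f c v u w = - fibre_sum K f c u v w" .
  have "fibre_sum K f c u w v = (\<Sum>x | x \<in> vertices K \<and> f x = u. \<Sum>y | y \<in> vertices K \<and> f y = w.
      \<Sum>z | z \<in> vertices K \<and> f z = v. - c [x, z, y])"
    unfolding fibre_sum_def by (intro sum.cong refl) (rule chain_swap_triple(2)[OF c])
  also have "\<dots> = (\<Sum>x | x \<in> vertices K \<and> f x = u. \<Sum>z | z \<in> vertices K \<and> f z = v.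
      \<Sum>y | y \<in> vertices K \<and> f y = w. - c [x, z, y])"
    by (intro sum.cong refl sum.swap)
  also have "\<dots> = - fibre_sum K f c u v w" unfolding fibre_sum_def sum_negf ..
  finally show "fibre_sum K f c u w v = - fibre_sum K f c u v w" .
qed

text \<open>When two of the target vertices agree, the defining case distinction of the push-forward
  yields 0, and so does the sum over the fibres, because it is antisymmetric. Having one formula for
  both cases is what makes the push-forward visibly commute with the boundary.\<close>

lemma push_chain_eq_fibre_sum:
  assumes c: "c \<in> chains 2 K"
  shows "push_chain K f c [u, v, w] = fibre_sum K f c u v w"
proof (cases "distinct [u, v, w]")
  case True
  let ?F = "\<lambda>u. {x. x \<in> vertices K \<and> f x = u}"
  have eq: "{xs. set xs \<subseteq> vertices K \<and> map f xs = [u, v, w]}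
    = (\<lambda>(x, y, z). [x, y, z]) ` (?F u \<times> ?F v \<times> ?F w)" (is "?A = ?B")
  proof (rule set_eqI, rule iffI)
    fix xs assume xs: "xs \<in> ?A"
    then obtain x y z where "xs = [x, y, z]" by (auto simp: map_eq_Cons_conv)
    then show "xs \<in> ?B" using xs by (intro image_eqI[of _ _ "(x, y, z)"]) auto
  qed auto
  have "push_chain K f c [u, v, w] = (\<Sum>t\<in>?F u \<times> ?F v \<times> ?F w. c (case t of (x, y, z) \<Rightarrow> [x, y, z]))"
    using True unfolding push_chain_def eq by (subst sum.reindex) (auto simp: inj_on_def)
  then show ?thesis by (simp add: fibre_sum_def sum.cartesian_product case_prod_unfold)
next
  case False
  then consider "u = v" | "v = w" | "u = w" by auto
  then have "fibre_sum K f c u v w = 0"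
  proof cases
    case 1 then show ?thesis using fibre_sum_swap(1)[OF c, of f v u w] by simp
  next
    case 2 then show ?thesis using fibre_sum_swap(2)[OF c, of f u w v] by simp
  next
    case 3
    then show ?thesis
      using fibre_sum_swap(1)[OF c, of f u v w] fibre_sum_swap(2)[OF c, of f v u w] by simp
  qed
  then show ?thesis using False unfolding push_chain_def by auto
qed

text \<open>The boundary coefficient at \<open>[u, v]\<close> sums the fibre sums over all target vertices
  \<open>w\<close>. The fibres partition the vertices of the domain, so the sum regroups into boundary
  coefficients of the original cycle.\<close>

lemma push_chain_cycle:
  assumes K: "finite (vertices K)" and L: "finite (vertices L)" and f: "simplicial_map K L f"
    and c: "c \<in> cycles 2 K"
  shows "push_chain K f c \<in> cycles 2 L"
proof -
  have ch: "c \<in> chains 2 K" and bd: "\<And>xs. boundary K c xs = 0"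
    using c unfolding cycles_def by auto
  have c0: "length xs = 3 \<and> set xs \<in> K" if "c xs \<noteq> 0" for xs
    using that chains_support[OF ch] by auto
  have supp: "length ys = 3 \<and> distinct ys \<and> set ys \<in> L" if "push_chain K f c ys \<noteq> 0" for ys
  proof -
    have d: "distinct ys" using that unfolding push_chain_def by (auto split: if_splits)
    then have "(\<Sum>xs | set xs \<subseteq> vertices K \<and> map f xs = ys. c xs) \<noteq> 0"
      using that unfolding push_chain_def by simp
    then obtain xs where "map f xs = ys" "c xs \<noteq> 0"
      by (rule sum.not_neutral_contains_not_neutral) auto
    then show ?thesis
      using d c0[of xs] f unfolding simplicial_map_def by auto
  qed
  have swap: "push_chain K f c (xs @ y # z # zs) = - push_chain K f c (xs @ z # y # zs)" for xs y z zs
  proof (cases "length (xs @ y # z # zs) = 3")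
    case False
    then show ?thesis using supp[of "xs @ y # z # zs"] supp[of "xs @ z # y # zs"] by fastforce
  next
    case True
    have 1: "push_chain K f c [v, u, w] = - push_chain K f c [u, v, w]" for u v w
      unfolding push_chain_eq_fibre_sum[OF ch] by (rule fibre_sum_swap(1)[OF ch])
    have 2: "push_chain K f c [u, w, v] = - push_chain K f c [u, v, w]" for u v w
      unfolding push_chain_eq_fibre_sum[OF ch] by (rule fibre_sum_swap(2)[OF ch])
    consider w where "xs = []" "zs = [w]" | w where "xs = [w]" "zs = []"
      using True by (cases xs; cases zs) auto
    then show ?thesis by cases (simp_all add: 1[of z y] 2[of _ z y])
  qed
  have "boundary L (push_chain K f c) xs = 0" for xs
  proof (cases "length xs = 2")
    case False
    then have "push_chain K f c (w # xs) = 0" for w using supp[of "w # xs"] by auto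
    then show ?thesis unfolding boundary_def by simp
  next
    case True
    then obtain u v where xs: "xs = [u, v]" by (auto simp: length_Suc_conv numeral_2_eq_2)
    let ?F = "\<lambda>u. {x \<in> vertices K. f x = u}"
    let ?g = "\<lambda>x. \<Sum>y\<in>?F u. \<Sum>z\<in>?F v. c [x, y, z]"
    have "boundary L (push_chain K f c) xs = (\<Sum>w\<in>vertices L. sum ?g (?F w))"
      unfolding boundary_def xs push_chain_eq_fibre_sum[OF ch] fibre_sum_def ..
    also have "\<dots> = sum ?g (vertices K)"
      by (rule sum.group[OF K L]) (use f in \<open>auto simp: simplicial_map_def\<close>)
    also have "\<dots> = (\<Sum>y\<in>?F u. \<Sum>x\<in>vertices K. \<Sum>z\<in>?F v. c [x, y, z])"
      by (rule sum.swap)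
    also have "\<dots> = (\<Sum>y\<in>?F u. \<Sum>z\<in>?F v. \<Sum>x\<in>vertices K. c [x, y, z])"
      by (intro sum.cong refl sum.swap)
    also have "\<dots> = 0"
      using bd unfolding boundary_def by simp
    finally show ?thesis .
  qed
  moreover have "push_chain K f c \<in> chains 2 L"
  proof (rule chainsI)
    fix ys assume "push_chain K f c ys \<noteq> 0"
    from supp[OF this] show "length ys = Suc 2 \<and> distinct ys \<and> set ys \<in> L" by simp
  qed (rule swap)
  ultimately show ?thesis unfolding cycles_def by blast
qed

section \<open>Oriented two-dimensional pseudomanifolds\<close>

definition triangle_complex :: "('v \<Rightarrow> 'v \<Rightarrow> 'v \<Rightarrow> bool) \<Rightarrow> 'v set set" where
  "triangle_complex P = {s. s \<noteq> {} \<and> (\<exists>x y z. P x y z \<and> s \<subseteq> {x, y, z})}"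

text \<open>Each positively oriented triangle occurs in the relation with its three cyclic rotations, which
  are even permutations; the transposed triple stands for the opposite orientation.\<close>

fun orientation_chain :: "('v \<Rightarrow> 'v \<Rightarrow> 'v \<Rightarrow> bool) \<Rightarrow> 'v list \<Rightarrow> int" where
  "orientation_chain P [x, y, z] = of_bool (P x y z) - of_bool (P y x z)"
| "orientation_chain P _ = 0"

text \<open>Any two triangles are joined by a chain of triangles sharing edges. The property is phrased
  through labels \<open>r\<close> of the triangles that do not change across edges because this is
  the form in which it is applied: the coefficients of a cycle are such labels.\<close>

definition edge_connected :: "('v \<Rightarrow> 'v \<Rightarrow> 'v \<Rightarrow> bool) \<Rightarrow> bool" where
  "edge_connected P \<longleftrightarrow> (\<forall>r :: 'v \<Rightarrow> 'v \<Rightarrow> 'v \<Rightarrow> int.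
     (\<forall>x y z. P x y z \<longrightarrow> r y z x = r x y z) \<longrightarrow>
     (\<forall>x y z w. P x y z \<longrightarrow> P y x w \<longrightarrow> r x y z = r y x w) \<longrightarrow>
     (\<exists>k. \<forall>x y z. P x y z \<longrightarrow> r x y z = k))"

lemma edge_connectedD:
  assumes "edge_connected P"
    and "\<And>x y z. P x y z \<Longrightarrow> r y z x = r x y z"
    and "\<And>x y z w. P x y z \<Longrightarrow> P y x w \<Longrightarrow> r x y z = (r y x w :: int)"
  obtains k where "\<And>x y z. P x y z \<Longrightarrow> r x y z = k"
  using assms unfolding edge_connected_def by (metis (no_types, lifting))

lemma orientation_chain_length: "orientation_chain P xs \<noteq> 0 \<Longrightarrow> length xs = 3"
  by (cases "(P, xs)" rule: orientation_chain.cases) auto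

text \<open>In \<open>P x y z\<close> the pair \<open>(x, y)\<close> is a directed edge and \<open>z\<close> the
  third vertex of the triangle to its left. The assumptions \<open>unique\<close> and
  \<open>opposite\<close> say that every edge lies in exactly two triangles, which induce opposite
  directions on it; \<open>asym\<close> excludes that these two have the same vertex set. All of
  these are conditions on edges, which is where a fundamental cycle is decided; the topology of the
  carriers is treated separately.\<close>

locale oriented_pseudomanifold =
  fixes P :: "'v \<Rightarrow> 'v \<Rightarrow> 'v \<Rightarrow> bool"
  assumes finite_triangles: "finite {s. \<exists>x y z. P x y z \<and> s = {x, y, z}}"
    and rotate: "P x y z \<Longrightarrow> P y z x"
    and unique: "P x y z \<Longrightarrow> P x y z' \<Longrightarrow> z = z'"
    and opposite: "P x y z \<Longrightarrow> \<exists>w. P y x w"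
    and asym: "P x y z \<Longrightarrow> \<not> P y x z"
    and nonempty: "\<exists>x y z. P x y z"
    and connected: "edge_connected P"
begin

abbreviation "K \<equiv> triangle_complex P"

lemma vertices_distinct: "P x y z \<Longrightarrow> x \<noteq> y \<and> y \<noteq> z \<and> x \<noteq> z"
  using asym rotate by blast

lemma card_le_3: "s \<in> K \<Longrightarrow> card s \<le> 3"
proof -
  assume "s \<in> K"
  then obtain x y z where "s \<subseteq> {x, y, z}" unfolding triangle_complex_def by blast
  then have "card s \<le> card {x, y, z}" by (intro card_mono) auto
  also have "\<dots> \<le> 3" by (simp add: card_insert_if)
  finally show ?thesis .
qed

lemma homologous_iff_eq: "homologous 2 K c c' \<longleftrightarrow> c = c'"
  by (rule homologous_2_iff_eq) (rule card_le_3)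

lemma complex: "simplicial_complex K"
proof -
  have "K \<subseteq> (\<Union>s\<in>{s. \<exists>x y z. P x y z \<and> s = {x, y, z}}. Pow s)"
    unfolding triangle_complex_def by blast
  moreover have "finite (\<Union>s\<in>{s. \<exists>x y z. P x y z \<and> s = {x, y, z}}. Pow s)"
    using finite_triangles by (rule finite_UN_I) auto
  ultimately have "finite K" by (rule finite_subset)
  moreover have "finite s" if "s \<in> K" for s
    using that finite_subset unfolding triangle_complex_def by blast
  moreover have "t \<in> K" if "s \<in> K" "t \<subseteq> s" "t \<noteq> {}" for s t
    using that unfolding triangle_complex_def by (smt (verit) mem_Collect_eq subset_trans)
  moreover have "{} \<notin> K" unfolding triangle_complex_def by simp
  ultimately show ?thesis
    unfolding simplicial_complex_def by metis
qed

lemma finite_vertices: "finite (vertices K)"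
  using complex unfolding simplicial_complex_def by blast

lemma triangle_mem: "P x y z \<Longrightarrow> {x, y, z} \<in> K"
  unfolding triangle_complex_def by blast

lemma vertices_mem: "P x y z \<Longrightarrow> x \<in> vertices K \<and> y \<in> vertices K \<and> z \<in> vertices K"
  using triangle_mem by blast

lemma mem_triangle_complexD:
  assumes "{x, y, z} \<in> K" "distinct [x, y, z]"
  shows "P x y z \<or> P y x z"
proof -
  obtain a b c where P: "P a b c" and sub: "{x, y, z} \<subseteq> {a, b, c}"
    using assms unfolding triangle_complex_def by blast
  have "P b c a" "P c a b" using P rotate by blast+
  then show ?thesis using P sub assms(2) by auto
qed

text \<open>Of the six orderings of a vertex set, three are rotations of the positive one and the other three
  are ruled out by asymmetry.\<close>

lemma same_triangle:
  assumes P: "P x y z" and Q: "P a b c" and eq: "{x, y, z} = {a, b, c}"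
  shows "(a, b, c) \<in> {(x, y, z), (y, z, x), (z, x, y)}"
proof -
  have d: "x \<noteq> y" "y \<noteq> z" "x \<noteq> z" "a \<noteq> b" "b \<noteq> c" "a \<noteq> c"
    using vertices_distinct P Q by blast+
  have n: "\<not> P y x z" "\<not> P x z y" "\<not> P z y x"
    using asym P rotate by blast+
  have "a \<in> {x, y, z}" "b \<in> {x, y, z}" "c \<in> {x, y, z}" using eq by auto
  then show ?thesis using d n Q by auto
qed

lemma opposite_other:
  assumes "P x y z"
  obtains w where "P y x w" "{y, x, w} \<noteq> {x, y, z}"
proof -
  obtain w where w: "P y x w" using opposite assms by blast
  have "w \<noteq> z" using asym[OF assms] w by auto
  then have "{y, x, w} \<noteq> {x, y, z}" using vertices_distinct[OF w] by auto
  then show thesis using that w by blast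
qed

lemma orientation_chain_chains: "orientation_chain P \<in> chains 2 K"
proof -
  have supp: "length xs = 3 \<and> distinct xs \<and> set xs \<in> K" if nz: "orientation_chain P xs \<noteq> 0" for xs
  proof -
    have "length xs = 3" using orientation_chain_length[OF nz] .
    then obtain x y z where xs: "xs = [x, y, z]" by (auto simp: length_Suc_conv numeral_3_eq_3)
    then have "P x y z \<or> P y x z" using nz by auto
    then show ?thesis
      using vertices_distinct triangle_mem[of x y z] triangle_mem[of y x z] unfolding xs
      by (auto simp: insert_commute)
  qed
  have swap: "orientation_chain P (xs @ y # z # zs) = - orientation_chain P (xs @ z # y # zs)" for xs y z zs
  proof (cases "length (xs @ y # z # zs) = 3")
    case False
    then show ?thesis
      using orientation_chain_length[of P "xs @ y # z # zs"] orientation_chain_length[of P "xs @ z # y # zs"]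
      by fastforce
  next
    case True
    consider w where "xs = []" "zs = [w]" | w where "xs = [w]" "zs = []"
      using True by (cases xs; cases zs) auto
    then show ?thesis
    proof cases
      case 1
      then show ?thesis by simp
    next
      case (2 w)
      have "P w z y \<longleftrightarrow> P y w z" "P z w y \<longleftrightarrow> P w y z" using rotate by blast+
      then show ?thesis unfolding 2 by simp
    qed
  qed
  show ?thesis
  proof (rule chainsI)
    fix xs assume "orientation_chain P xs \<noteq> 0"
    from supp[OF this] show "length xs = Suc 2 \<and> distinct xs \<and> set xs \<in> K" by simp
  qed (rule swap)
qed

text \<open>Uniqueness of the third vertex turns the number of triangles to the left of an edge into 0 or 1;
  comparing the two directions of the edge then shows that the boundary vanishes.\<close>

lemma sum_of_bool_edge:
  "(\<Sum>w\<in>vertices K. of_bool (P x y w)) = (of_bool (\<exists>w. P x y w) :: int)"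
proof (cases "\<exists>w. P x y w")
  case True
  then obtain v where v: "P x y v" by blast
  then have "P x y w \<longleftrightarrow> w = v" for w using unique by blast
  then have "(\<Sum>w\<in>vertices K. of_bool (P x y w)) = (\<Sum>w\<in>vertices K. if w = v then 1 else (0::int))"
    by (intro sum.cong) auto
  also have "\<dots> = 1"
    using v vertices_mem[OF v] finite_vertices by (subst sum.delta) auto
  finally show ?thesis using True by simp
qed simp

lemma orientation_chain_cycle: "orientation_chain P \<in> cycles 2 K"
proof -
  have "boundary K (orientation_chain P) xs = 0" for xs
  proof (cases "length xs = 2")
    case False
    then have "orientation_chain P (w # xs) = 0" for w
      using orientation_chain_length[of P "w # xs"] by auto
    then show ?thesis unfolding boundary_def by simp
  next
    case True
    then obtain x y where xs: "xs = [x, y]" by (auto simp: length_Suc_conv numeral_2_eq_2)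
    have "P w x y \<longleftrightarrow> P x y w" "P x w y \<longleftrightarrow> P y x w" for w using rotate by blast+
    then have "boundary K (orientation_chain P) xs
        = (\<Sum>w\<in>vertices K. of_bool (P x y w)) - (\<Sum>w\<in>vertices K. of_bool (P y x w))"
      unfolding boundary_def xs by (simp add: sum_subtractf)
    also have "\<dots> = 0"
      unfolding sum_of_bool_edge using opposite by auto
    finally show ?thesis .
  qed
  then show ?thesis using orientation_chain_chains unfolding cycles_def by blast
qed

text \<open>Only the two triangles at an edge contribute to the boundary coefficient there, so the
  coefficients of a cycle on them agree. Connectedness across edges propagates this agreement to all
  triangles.\<close>

lemma cycle_eq_multiple:
  assumes z: "z \<in> cycles 2 K"
  obtains k where "z = (\<lambda>xs. k * orientation_chain P xs)"
proof -
  have ch: "z \<in> chains 2 K" and bd: "\<And>xs. boundary K z xs = 0"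
    using z unfolding cycles_def by auto
  have supp: "length xs = 3 \<and> distinct xs \<and> set xs \<in> K" if "z xs \<noteq> 0" for xs
    using that chains_support[OF ch] by auto
  have cross: "z [x, y, w] = z [y, x, w']" if P: "P x y w" and P': "P y x w'" for x y w w'
  proof -
    have w: "w \<noteq> w'" using P P' asym by blast
    have "z [v, x, y] = 0" if "v \<notin> {w, w'}" for v
    proof (rule ccontr)
      assume "z [v, x, y] \<noteq> 0"
      from supp[OF this] have "P v x y \<or> P x v y" using mem_triangle_complexD[of v x y] by auto
      then have "P x y v \<or> P y x v" using rotate by blast
      then show False using that P P' unique by blast
    qed
    then have "(\<Sum>v\<in>vertices K. z [v, x, y]) = (\<Sum>v\<in>{w, w'}. z [v, x, y])"
      using finite_vertices vertices_mem[OF P] vertices_mem[OF P']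
      by (intro sum.mono_neutral_right) auto
    then have "z [w, x, y] + z [w', x, y] = 0"
      using w bd[of "[x, y]"] unfolding boundary_def by simp
    moreover have "z [w, x, y] = z [x, y, w]"
      using chain_swap_triple[OF ch, of x w y] chain_swap_triple(2)[OF ch, of x y w] by linarith
    moreover have "z [w', x, y] = - z [y, x, w']"
      using chain_swap_triple(1)[OF ch, of w' x y] chain_swap_triple(2)[OF ch, of x w' y]
        chain_swap_triple(1)[OF ch, of y x w'] by linarith
    ultimately show ?thesis by linarith
  qed
  have rot: "z [y, w, x] = z [x, y, w]" for x y w
    using chain_swap_triple(1)[OF ch, of x y w] chain_swap_triple(2)[OF ch, of y x w] by linarith
  obtain k where k: "\<And>x y w. P x y w \<Longrightarrow> z [x, y, w] = k"
    by (rule edge_connectedD[OF connected, of "\<lambda>x y w. z [x, y, w]"]) (use rot cross in blast)+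
  have "z xs = k * orientation_chain P xs" for xs
  proof (cases "\<exists>x y w. xs = [x, y, w] \<and> (P x y w \<or> P y x w)")
    case True
    then obtain x y w where xs: "xs = [x, y, w]" and P: "P x y w \<or> P y x w" by blast
    show ?thesis
    proof (cases "P x y w")
      case True
      then show ?thesis using k[OF True] asym[OF True] unfolding xs by simp
    next
      case False
      then have "P y x w" using P by blast
      then show ?thesis using False k[of y x w] chain_swap_triple(1)[OF ch, of y x w] unfolding xs by simp
    qed
  next
    case False
    have "z xs = 0"
    proof (rule ccontr)
      assume nz: "z xs \<noteq> 0"
      then have "length xs = 3" using supp by blast
      then obtain x y w where xs: "xs = [x, y, w]"
        by (auto simp: length_Suc_conv numeral_3_eq_3)
      then have "P x y w \<or> P y x w"
        using supp[OF nz] mem_triangle_complexD[of x y w] by simp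
      then show False using False xs by blast
    qed
    moreover have "orientation_chain P xs = 0"
      using False by (cases "(P, xs)" rule: orientation_chain.cases) auto
    ultimately show ?thesis by simp
  qed
  then show thesis using that by blast
qed

lemma fundamental: "fundamental_cycle K (orientation_chain P)"
proof -
  obtain x y z where P: "P x y z" using nonempty by blast
  have one: "orientation_chain P [x, y, z] = 1" using P asym[OF P] by simp
  have "\<exists>!k. homologous 2 K z (\<lambda>xs. k * orientation_chain P xs)" if z: "z \<in> cycles 2 K" for z
  proof -
    obtain k where k: "z = (\<lambda>xs. k * orientation_chain P xs)" by (rule cycle_eq_multiple[OF z])
    show ?thesis
      unfolding homologous_iff_eq
    proof (rule ex1I[of _ k])
      fix k' assume "z = (\<lambda>xs. k' * orientation_chain P xs)"
      from fun_cong[OF this] fun_cong[OF k] one show "k' = k"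
        by (metis mult.right_neutral)
    qed (rule k)
  qed
  then show ?thesis unfolding fundamental_cycle_def using orientation_chain_cycle by blast
qed

text \<open>The coefficient of the push-forward is the number of triangles lying positively over
  \<open>[u, v, w]\<close> minus the number of those lying negatively over it.\<close>

lemma push_orientation_chain:
  "push_chain K f (orientation_chain P) [u, v, w] =
    int (card {(x, y, z). P x y z \<and> f x = u \<and> f y = v \<and> f z = w})
    - int (card {(x, y, z). P y x z \<and> f x = u \<and> f y = v \<and> f z = w})"
proof -
  define F where "F u = {x \<in> vertices K. f x = u}" for u
  let ?A = "F u \<times> F v \<times> F w"
  have "finite (F u)" for u
    unfolding F_def by (rule finite_subset[OF _ finite_vertices]) blast
  then have fin: "finite ?A" by (intro finite_cartesian_product)
  have *: "(\<Sum>t\<in>?A. of_bool (case t of (x, y, z) \<Rightarrow> Q x y z))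
      = int (card {(x, y, z). Q x y z \<and> f x = u \<and> f y = v \<and> f z = w})"
    if "\<forall>x y z. Q x y z \<longrightarrow> x \<in> vertices K \<and> y \<in> vertices K \<and> z \<in> vertices K" for Q
  proof -
    have "(\<Sum>t\<in>?A. of_bool (case t of (x, y, z) \<Rightarrow> Q x y z))
        = int (card (?A \<inter> {t. case t of (x, y, z) \<Rightarrow> Q x y z}))"
      using fin by (simp add: sum.If_cases of_bool_def)
    also have "?A \<inter> {t. case t of (x, y, z) \<Rightarrow> Q x y z} = {(x, y, z). Q x y z \<and> f x = u \<and> f y = v \<and> f z = w}"
      using that unfolding F_def by auto
    finally show ?thesis .
  qed
  have "push_chain K f (orientation_chain P) [u, v, w]
      = (\<Sum>t\<in>?A. of_bool (case t of (x, y, z) \<Rightarrow> P x y z) - of_bool (case t of (x, y, z) \<Rightarrow> P y x z))"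
    unfolding push_chain_eq_fibre_sum[OF orientation_chain_chains] fibre_sum_def F_def
    by (simp add: sum.cartesian_product case_prod_unfold)
  also have "\<dots> = int (card {(x, y, z). P x y z \<and> f x = u \<and> f y = v \<and> f z = w})
    - int (card {(x, y, z). P y x z \<and> f x = u \<and> f y = v \<and> f z = w})"
  proof -
    have vm: "\<forall>x y z. P x y z \<longrightarrow> x \<in> vertices K \<and> y \<in> vertices K \<and> z \<in> vertices K"
      by (intro allI impI) (rule vertices_mem)
    have vm': "\<forall>x y z. P y x z \<longrightarrow> x \<in> vertices K \<and> y \<in> vertices K \<and> z \<in> vertices K"
      by (intro allI impI) (drule vertices_mem, elim conjE, intro conjI)
    show ?thesis
      unfolding sum_subtractf *[of P, OF vm] *[of "\<lambda>x y z. P y x z", OF vm'] ..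
  qed
  finally show ?thesis .
qed

end

section \<open>Gluing two pseudomanifolds along a triangle\<close>

definition remove_triangle :: "'v set \<Rightarrow> ('v \<Rightarrow> 'v \<Rightarrow> 'v \<Rightarrow> bool) \<Rightarrow> 'v \<Rightarrow> 'v \<Rightarrow> 'v \<Rightarrow> bool" where
  "remove_triangle s P x y z \<longleftrightarrow> P x y z \<and> {x, y, z} \<noteq> s"

definition glue :: "'v set \<Rightarrow> ('v \<Rightarrow> 'v \<Rightarrow> 'v \<Rightarrow> bool) \<Rightarrow> ('v \<Rightarrow> 'v \<Rightarrow> 'v \<Rightarrow> bool) \<Rightarrow> 'v \<Rightarrow> 'v \<Rightarrow> 'v \<Rightarrow> bool" where
  "glue s P Q x y z \<longleftrightarrow> remove_triangle s P x y z \<or> remove_triangle s Q x y z"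

text \<open>The triangle \<open>(x0, y0, z0)\<close> is positive in \<open>P\<close> and negative in
  \<open>Q\<close>. This makes the directions of its edges fit together once the triangle itself is
  gone.\<close>

locale triangle_gluing = P: oriented_pseudomanifold P + Q: oriented_pseudomanifold Q
  for P Q :: "'v \<Rightarrow> 'v \<Rightarrow> 'v \<Rightarrow> bool" +
  fixes x0 y0 z0 :: 'v
  assumes P0: "P x0 y0 z0" and Q0: "Q y0 x0 z0"
    and common_vertices: "vertices (triangle_complex P) \<inter> vertices (triangle_complex Q) \<subseteq> {x0, y0, z0}"
    and connected_P: "edge_connected (remove_triangle {x0, y0, z0} P)"
    and connected_Q: "edge_connected (remove_triangle {x0, y0, z0} Q)"
begin

lemma swap_gluing: "triangle_gluing Q P y0 x0 z0"
proof -
  have "{y0, x0, z0} = {x0, y0, z0}" by blast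
  then show ?thesis
    using P.oriented_pseudomanifold_axioms Q.oriented_pseudomanifold_axioms P0 Q0 common_vertices connected_P connected_Q
    by (simp add: triangle_gluing_def triangle_gluing_axioms_def Int_commute)
qed

lemma distinct0: "x0 \<noteq> y0" "y0 \<noteq> z0" "x0 \<noteq> z0"
  using P.vertices_distinct[OF P0] by auto

text \<open>A directed edge shared by both sides lies on the seam. There one of \<open>P\<close> and
  \<open>Q\<close> has the removed triangle to its left, so only the other can have a remaining one.\<close>

lemma no_common_edge:
  assumes P: "remove_triangle {x0, y0, z0} P x y z" and Q: "remove_triangle {x0, y0, z0} Q x y w"
  shows False
proof -
  have Pxyz: "P x y z" "{x, y, z} \<noteq> {x0, y0, z0}" and Qxyw: "Q x y w" "{x, y, w} \<noteq> {x0, y0, z0}"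
    using P Q by (simp_all add: remove_triangle_def)
  have xy: "x \<in> {x0, y0, z0}" "y \<in> {x0, y0, z0}" "x \<noteq> y"
    using common_vertices P.vertices_mem[OF Pxyz(1)] Q.vertices_mem[OF Qxyw(1)]
      P.vertices_distinct[OF Pxyz(1)] by blast+
  have rotP: "P y0 z0 x0" "P z0 x0 y0" using P.rotate P0 by blast+
  have rotQ: "Q x0 z0 y0" "Q z0 y0 x0" using Q.rotate Q0 by blast+
  from xy consider "x = x0" "y = y0" | "x = y0" "y = z0" | "x = z0" "y = x0"
    | "x = y0" "y = x0" | "x = x0" "y = z0" | "x = z0" "y = y0" by blast
  then show False
  proof cases
    case 1 then show False using P.unique[OF P0] Pxyz by blast
  next
    case 2 then show False using P.unique[OF rotP(1)] Pxyz by blast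
  next
    case 3 then show False using P.unique[OF rotP(2)] Pxyz by blast
  next
    case 4 then show False using Q.unique[OF Q0] Qxyw by blast
  next
    case 5 then show False using Q.unique[OF rotQ(1)] Qxyw by blast
  next
    case 6 then show False using Q.unique[OF rotQ(2)] Qxyw by blast
  qed
qed

text \<open>If the neighbour of a \<open>P\<close>-triangle across an edge is the removed triangle, then the
  neighbour of the removed triangle in \<open>Q\<close> takes its place.\<close>

lemma glue_opposite:
  assumes P: "remove_triangle {x0, y0, z0} P x y z"
  shows "\<exists>w. glue {x0, y0, z0} P Q y x w"
proof -
  have Pxyz: "P x y z" using P by (simp add: remove_triangle_def)
  then obtain w where w: "P y x w" using P.opposite by blast
  show ?thesis
  proof (cases "{y, x, w} = {x0, y0, z0}")
    case False
    then show ?thesis using w unfolding glue_def remove_triangle_def by blast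
  next
    case True
    have "(y, x, w) \<in> {(x0, y0, z0), (y0, z0, x0), (z0, x0, y0)}"
      using P.same_triangle[OF P0 w] True by simp
    moreover have "Q x0 z0 y0" "Q z0 y0 x0" using Q.rotate Q0 by blast+
    ultimately have "Q x y w" using Q0 by auto
    then obtain v where v: "Q y x v" "{y, x, v} \<noteq> {x, y, w}" by (rule Q.opposite_other)
    have "{x, y, w} = {y, x, w}" by blast
    then have "{y, x, v} \<noteq> {x0, y0, z0}" using v(2) True by simp
    then show ?thesis using v(1) unfolding glue_def remove_triangle_def by blast
  qed
qed

lemma triangle_at_seam: obtains w where "remove_triangle {x0, y0, z0} P y0 x0 w"
  using P.opposite_other[OF P0] unfolding remove_triangle_def by metis

end

context triangle_gluing
begin

interpretation swapped: triangle_gluing Q P y0 x0 z0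
  by (rule swap_gluing)

lemma seam_eq: "{y0, x0, z0} = {x0, y0, z0}"
  by blast

lemma oriented_pseudomanifold_glue: "oriented_pseudomanifold (glue {x0, y0, z0} P Q)"
proof -
  let ?s = "{x0, y0, z0}"
  let ?P = "remove_triangle ?s P" and ?Q = "remove_triangle ?s Q" and ?R = "glue ?s P Q"
  \<comment> \<open>Two remaining triangles that meet along the seam connect the two sides.\<close>
  obtain w where w: "?P y0 x0 w" by (rule triangle_at_seam)
  obtain w' where w': "?Q x0 y0 w'"
    using swapped.triangle_at_seam unfolding seam_eq by blast
  show ?thesis
  proof
    have "{s. \<exists>x y z. ?R x y z \<and> s = {x, y, z}} \<subseteq>
        {s. \<exists>x y z. P x y z \<and> s = {x, y, z}} \<union> {s. \<exists>x y z. Q x y z \<and> s = {x, y, z}}"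
      unfolding glue_def remove_triangle_def by blast
    then show "finite {s. \<exists>x y z. ?R x y z \<and> s = {x, y, z}}"
      by (rule finite_subset) (use P.finite_triangles Q.finite_triangles in blast)
  next
    fix x y z assume R: "?R x y z"
    have e: "{y, z, x} = {x, y, z}" by blast
    show "?R y z x"
      using R P.rotate[of x y z] Q.rotate[of x y z] unfolding glue_def remove_triangle_def e by blast
  next
    fix x y z z' assume "?R x y z" "?R x y z'"
    then consider "P x y z" "P x y z'" | "Q x y z" "Q x y z'" | "?P x y z" "?Q x y z'" | "?P x y z'" "?Q x y z"
      unfolding glue_def by (auto simp: remove_triangle_def)
    then show "z = z'" using P.unique Q.unique no_common_edge by cases blast+
  next
    fix x y z assume "?R x y z"
    then consider "?P x y z" | "?Q x y z" unfolding glue_def by blast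
    then show "\<exists>w. ?R y x w"
    proof cases
      case 1 then show ?thesis by (rule glue_opposite)
    next
      case 2
      then have "\<exists>w. glue ?s Q P y x w" using swapped.glue_opposite unfolding seam_eq by blast
      then show ?thesis unfolding glue_def by blast
    qed
  next
    have mixed: False if P: "?P x y z" and Q: "?Q y x z" for x y z
    proof -
      have "P x y z" "Q y x z" "{x, y, z} \<noteq> ?s" using P Q by (simp_all add: remove_triangle_def)
      moreover from this have "{x, y, z} \<subseteq> ?s"
        using common_vertices P.vertices_mem[of x y z] Q.vertices_mem[of y x z] by blast
      moreover have "card {x, y, z} = 3" using P.vertices_distinct[OF \<open>P x y z\<close>] by simp
      moreover have "card ?s = 3" using distinct0 by simp
      ultimately show False using card_subset_eq[of ?s "{x, y, z}"] by simp
    qed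
    fix x y z assume "?R x y z"
    moreover have "?R y x z \<Longrightarrow> ?P x y z \<Longrightarrow> False" "?R y x z \<Longrightarrow> ?Q x y z \<Longrightarrow> False"
      using mixed[of x y z] mixed[of y x z] P.asym[of x y z] Q.asym[of x y z]
      unfolding glue_def by (auto simp: remove_triangle_def)
    ultimately show "\<not> ?R y x z" unfolding glue_def by blast
  next
    show "\<exists>x y z. ?R x y z" using w unfolding glue_def by blast
  next
    show "edge_connected ?R"
      unfolding edge_connected_def
    proof (intro allI impI)
      fix r :: "'v \<Rightarrow> 'v \<Rightarrow> 'v \<Rightarrow> int"
      assume "\<forall>x y z. ?R x y z \<longrightarrow> r y z x = r x y z"
        and "\<forall>x y z w. ?R x y z \<longrightarrow> ?R y x w \<longrightarrow> r x y z = r y x w"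
      then have rot: "\<And>x y z. ?R x y z \<Longrightarrow> r y z x = r x y z"
        and cross: "\<And>x y z w. ?R x y z \<Longrightarrow> ?R y x w \<Longrightarrow> r x y z = r y x w" by blast+
      have PR: "?P x y z \<Longrightarrow> ?R x y z" and QR: "?Q x y z \<Longrightarrow> ?R x y z" for x y z
        unfolding glue_def by blast+
      obtain k where k: "\<And>x y z. ?P x y z \<Longrightarrow> r x y z = k"
      proof (rule edge_connectedD[OF connected_P, of r])
        show "r y z x = r x y z" if "?P x y z" for x y z by (rule rot[OF PR[OF that]])
        show "r x y z = r y x w" if "?P x y z" "?P y x w" for x y z w
          by (rule cross[OF PR[OF that(1)] PR[OF that(2)]])
      qed (rule that)
      obtain m where m: "\<And>x y z. ?Q x y z \<Longrightarrow> r x y z = m"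
      proof (rule edge_connectedD[OF connected_Q, of r])
        show "r y z x = r x y z" if "?Q x y z" for x y z by (rule rot[OF QR[OF that]])
        show "r x y z = r y x w" if "?Q x y z" "?Q y x w" for x y z w
          by (rule cross[OF QR[OF that(1)] QR[OF that(2)]])
      qed (rule that)
      have km: "k = m"
        using k[OF w] m[OF w'] cross[OF PR[OF w] QR[OF w']] by simp
      have "r x y z = k" if "?R x y z" for x y z
        using that k[of x y z] m[of x y z] km unfolding glue_def by argo
      then show "\<exists>k. \<forall>x y z. ?R x y z \<longrightarrow> r x y z = k" by blast
    qed
  qed
qed

lemma face_of_removed_triangle:
  assumes "s \<subset> {x0, y0, z0}"
  obtains x y z where "remove_triangle {x0, y0, z0} P x y z" "s \<subseteq> {x, y, z}"
proof -
  have "P y0 z0 x0" "P z0 x0 y0" using P.rotate P0 by blast+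
  moreover have "s \<subseteq> {x0, y0} \<or> s \<subseteq> {y0, z0} \<or> s \<subseteq> {z0, x0}" using assms by blast
  ultimately obtain x y z where xyz: "P x y z" "s \<subseteq> {x, y}" "{x, y, z} = {x0, y0, z0}"
    using P0 by (metis insert_commute)
  obtain w where "P y x w" "{y, x, w} \<noteq> {x, y, z}" by (rule P.opposite_other[OF xyz(1)])
  then have "remove_triangle {x0, y0, z0} P y x w" using xyz(3) by (simp add: remove_triangle_def)
  then show thesis by (rule that) (use xyz(2) in blast)
qed

text \<open>Removing the triangle keeps its edges, since each of them lies in a second triangle, and no other
  triangle contains all three of its vertices.\<close>

lemma triangle_complex_remove:
  "triangle_complex (remove_triangle {x0, y0, z0} P) = triangle_complex P - {{x0, y0, z0}}"
proof (rule set_eqI, rule iffI)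
  let ?s = "{x0, y0, z0}"
  fix t assume "t \<in> triangle_complex (remove_triangle ?s P)"
  then obtain x y z where t: "t \<noteq> {}" "P x y z" "{x, y, z} \<noteq> ?s" "t \<subseteq> {x, y, z}"
    unfolding triangle_complex_def remove_triangle_def by blast
  have "t \<noteq> ?s"
  proof
    assume "t = ?s"
    then have "?s = {x, y, z}"
      using t distinct0 P.vertices_distinct[OF t(2)] by (intro card_subset_eq) auto
    then show False using t by simp
  qed
  then show "t \<in> triangle_complex P - {?s}" using t unfolding triangle_complex_def by blast
next
  let ?s = "{x0, y0, z0}"
  fix t assume "t \<in> triangle_complex P - {?s}"
  then obtain x y z where t: "t \<noteq> {}" "P x y z" "t \<subseteq> {x, y, z}" "t \<noteq> ?s"
    unfolding triangle_complex_def by blast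
  obtain x' y' z' where "remove_triangle ?s P x' y' z'" "t \<subseteq> {x', y', z'}"
  proof (cases "{x, y, z} = ?s")
    case True
    then have "t \<subset> ?s" using t by blast
    then show thesis using face_of_removed_triangle that by blast
  next
    case False
    then show thesis using that[of x y z] t by (simp add: remove_triangle_def)
  qed
  then show "t \<in> triangle_complex (remove_triangle ?s P)"
    unfolding triangle_complex_def using t(1) by blast
qed

end

context triangle_gluing
begin

interpretation swapped: triangle_gluing Q P y0 x0 z0
  by (rule swap_gluing)

lemma triangle_complex_glue:
  "triangle_complex (glue {x0, y0, z0} P Q) = triangle_complex P \<union> triangle_complex Q - {{x0, y0, z0}}"
proof -
  have "triangle_complex (glue {x0, y0, z0} P Q) =
      triangle_complex (remove_triangle {x0, y0, z0} P) \<union> triangle_complex (remove_triangle {x0, y0, z0} Q)"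
    unfolding triangle_complex_def glue_def by blast
  then show ?thesis
    unfolding triangle_complex_remove swapped.triangle_complex_remove[unfolded seam_eq] by blast
qed

lemma triangle_complex_Int: "triangle_complex P \<inter> triangle_complex Q = Pow {x0, y0, z0} - {{}}"
proof
  show "triangle_complex P \<inter> triangle_complex Q \<subseteq> Pow {x0, y0, z0} - {{}}"
  proof
    fix s assume s: "s \<in> triangle_complex P \<inter> triangle_complex Q"
    then have "s \<subseteq> {x0, y0, z0}" using common_vertices by blast
    moreover have "s \<noteq> {}" using s unfolding triangle_complex_def by blast
    ultimately show "s \<in> Pow {x0, y0, z0} - {{}}" by blast
  qed
  show "Pow {x0, y0, z0} - {{}} \<subseteq> triangle_complex P \<inter> triangle_complex Q"
    using P0 Q0 unfolding triangle_complex_def by blast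
qed

lemma simplicial_complex_remove: "simplicial_complex (triangle_complex P - {{x0, y0, z0}})"
proof -
  have "finite (triangle_complex P - {{x0, y0, z0}})" "\<forall>s\<in>triangle_complex P - {{x0, y0, z0}}. finite s"
    using P.complex unfolding simplicial_complex_def by blast+
  then show ?thesis
    unfolding simplicial_complex_def triangle_complex_remove[symmetric]
    unfolding triangle_complex_def by (blast intro: subset_trans)
qed

end

section \<open>Connected sums of geometric carriers\<close>

lemma embedding_map_compact_injective:
  fixes f :: "'a::metric_space \<Rightarrow> 'b::metric_space"
  assumes "compact S" "continuous_on S f" "inj_on f S" "f ` S \<subseteq> T"
  shows "embedding_map (top_of_set S) (top_of_set T) f"
proof (rule injective_closed_imp_embedding_map)
  show "continuous_map (top_of_set S) (top_of_set T) f"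
    using assms by auto
  then show "closed_map (top_of_set S) (top_of_set T) f"
    using assms(1) by (intro T1_Spaces.continuous_imp_closed_map)
      (simp_all add: compact_space_subtopology Hausdorff_space_subtopology)
qed (use assms in simp)

text \<open>A homeomorphism between the disc and the triangle exists because both are compact convex sets with
  interior. By invariance of domain it carries interior to interior, which is the extra
  information needed for cutting out open discs.\<close>

lemma standard_triangle_disc:
  defines "T \<equiv> {u::complex. 0 \<le> Re u \<and> 0 \<le> Im u \<and> Re u + Im u \<le> 1}"
    and "T' \<equiv> {u::complex. 0 < Re u \<and> 0 < Im u \<and> Re u + Im u < 1}"
  obtains g :: "complex \<Rightarrow> complex"
  where "continuous_on (cball 0 1) g" "inj_on g (cball 0 1)" "g ` cball 0 1 = T" "g ` ball 0 1 = T'"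
proof -
  have halfspaces: "T = {u. 0 \<le> inner 1 u} \<inter> {u. 0 \<le> inner \<i> u} \<inter> {u. inner (1 + \<i>) u \<le> 1}"
    "T' = {u. 0 < inner 1 u} \<inter> {u. 0 < inner \<i> u} \<inter> {u. inner (1 + \<i>) u < 1}"
    by (auto simp: T_def T'_def inner_complex_def)
  have "closed T"
    unfolding halfspaces by (intro closed_Int closed_halfspace_ge closed_halfspace_le)
  moreover have "T \<subseteq> cball 0 2"
  proof
    fix u assume "u \<in> T"
    then show "u \<in> cball 0 2"
      using cmod_le[of u] by (auto simp: T_def)
  qed
  ultimately have "compact T"
    using bounded_subset[OF bounded_cball] compact_eq_bounded_closed by blast
  moreover have "convex T"
    unfolding halfspaces by (intro convex_Int convex_halfspace_ge convex_halfspace_le)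
  moreover have T': "interior T = T'"
  proof -
    have ge: "interior {u::complex. 0 \<le> inner a u} = {u. 0 < inner a u}" if "a \<noteq> 0" for a
      using interior_halfspace_ge[OF that, of 0] by simp
    have le: "interior {u::complex. inner (1 + \<i>) u \<le> 1} = {u. inner (1 + \<i>) u < 1}"
      by (rule interior_halfspace_le) (simp add: complex_eq_iff)
    show ?thesis
      unfolding halfspaces interior_Int le ge[OF one_neq_zero] ge[OF complex_i_not_zero] ..
  qed
  moreover have "Complex (1/4) (1/4) \<in> T'" by (simp add: T'_def)
  then have "interior T \<noteq> {}" unfolding T' by blast
  ultimately have "cball (0::complex) 1 homeomorphic T"
    using homeomorphic_convex_compact_cball[of T 1 0] homeomorphic_sym by (metis zero_less_one)
  then obtain g h where gh: "homeomorphism (cball (0::complex) 1) T g h"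
    unfolding homeomorphic_def by blast
  then have g: "continuous_on (cball 0 1) g" "g ` cball 0 1 = T" "inj_on g (cball 0 1)"
    and h: "continuous_on T h" "h ` T = cball 0 1" "inj_on h T"
    and gh_id: "\<And>u. u \<in> T \<Longrightarrow> g (h u) = u"
    unfolding homeomorphism_def by (auto intro: inj_on_inverseI)
  have "open (g ` ball 0 1)"
    using g by (intro invariance_of_domain) (auto intro: continuous_on_subset inj_on_subset)
  then have "g ` ball 0 1 \<subseteq> T'"
    unfolding T'[symmetric] using g(2) by (intro interior_maximal) auto
  moreover have "T' \<subseteq> g ` ball 0 1"
  proof -
    have sub: "T' \<subseteq> T" unfolding T'[symmetric] by (rule interior_subset)
    have "open (h ` T')"
      using h sub unfolding T'[symmetric]
      by (intro invariance_of_domain) (auto intro: continuous_on_subset inj_on_subset)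
    then have "h ` T' \<subseteq> interior (cball 0 1)"
      using h(2) sub by (intro interior_maximal) auto
    then have "g ` h ` T' \<subseteq> g ` ball 0 1" by (simp add: image_mono)
    moreover have "g ` h ` T' = T'" using gh_id sub by (force simp: image_iff)
    ultimately show ?thesis by simp
  qed
  ultimately show thesis using that g by blast
qed

text \<open>In barycentric coordinates the closed triangle is the carrier of the complex of all faces and the
  open triangle is the carrier of the single top simplex. The latter is not the carrier of a complex,
  but the same formula describes it.\<close>

lemma triangle_carrier_disc:
  fixes s :: "nat set"
  assumes "card s = 3"
  obtains e :: "complex \<Rightarrow> nat \<Rightarrow> real"
  where "continuous_on (cball 0 1) e" "inj_on e (cball 0 1)"
    "e ` cball 0 1 = geometric_carrier (Pow s - {{}})" "e ` ball 0 1 = geometric_carrier {s}"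
proof -
  obtain x y z where s: "s = {x, y, z}" and d: "x \<noteq> y" "y \<noteq> z" "x \<noteq> z"
    using assms card_3_iff[of s] by auto
  \<comment> \<open>The affine map from the standard triangle in the plane onto the triangle spanned by \<open>s\<close>.\<close>
  define a where "a u v = Re u * of_bool (v = x) + Im u * of_bool (v = y)
    + (1 - Re u - Im u) * of_bool (v = z)" for u :: complex and v
  have at: "a u x = Re u" "a u y = Im u" "a u z = 1 - Re u - Im u" for u
    using d by (auto simp: a_def)
  have off: "a u v = 0" if "v \<notin> s" for u v
    using that by (simp add: a_def s)
  have mem: "p \<in> geometric_carrier S \<longleftrightarrow>
      (\<forall>v. 0 \<le> p v) \<and> {v. p v \<noteq> 0} \<in> S \<and> p x + p y + p z = 1"
    if "\<And>v. v \<notin> s \<Longrightarrow> p v = 0" for p S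
  proof -
    have "(\<Sum>v | p v \<noteq> 0. p v) = sum p s"
      by (rule sum.mono_neutral_left) (use that in \<open>auto simp: s\<close>)
    then show ?thesis unfolding geometric_carrier_def using d by (simp add: s add.assoc)
  qed
  have a_mem: "a u \<in> geometric_carrier S \<longleftrightarrow>
      (0 \<le> Re u \<and> 0 \<le> Im u \<and> Re u + Im u \<le> 1) \<and> {v. a u v \<noteq> 0} \<in> S" for u S
  proof -
    have "(\<forall>v. 0 \<le> a u v) \<longleftrightarrow> (0 \<le> a u x \<and> 0 \<le> a u y \<and> 0 \<le> a u z)"
      using off s by (metis insertE order_refl singletonD)
    also have "\<dots> \<longleftrightarrow> 0 \<le> Re u \<and> 0 \<le> Im u \<and> Re u + Im u \<le> 1"
      unfolding at by auto
    finally show ?thesis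
      using mem[of "a u" S] off at by auto
  qed
  have a_onto: "\<exists>u. p = a u" if p: "p \<in> geometric_carrier S" and sub: "{v. p v \<noteq> 0} \<subseteq> s" for p S
  proof -
    have p0: "p v = 0" if "v \<notin> s" for v using that sub by blast
    have sum: "p x + p y + p z = 1" using p mem[of p S, OF p0] by blast
    have "p v = a (Complex (p x) (p y)) v" for v
    proof (cases "v \<in> s")
      case True
      then show ?thesis using at sum unfolding s by auto
    next
      case False
      then show ?thesis using p0 off by simp
    qed
    then have "p = a (Complex (p x) (p y))" by (rule ext)
    then show ?thesis by blast
  qed
  have inj: "inj a"
    by (rule injI) (metis at(1,2) complex_eq_iff)
  have cont: "continuous_on A a" for A
    unfolding a_def by (intro continuous_intros)
  have closed: "a ` {u. 0 \<le> Re u \<and> 0 \<le> Im u \<and> Re u + Im u \<le> 1} = geometric_carrier (Pow s - {{}})"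
  proof (rule set_eqI, rule iffI)
    fix p assume "p \<in> a ` {u. 0 \<le> Re u \<and> 0 \<le> Im u \<and> Re u + Im u \<le> 1}"
    then obtain u where p: "p = a u" and u: "0 \<le> Re u \<and> 0 \<le> Im u \<and> Re u + Im u \<le> 1" by blast
    have "{v. a u v \<noteq> 0} \<noteq> {}"
    proof
      assume "{v. a u v \<noteq> 0} = {}"
      then have "a u x = 0" "a u y = 0" "a u z = 0" by blast+
      then show False unfolding at by simp
    qed
    moreover have "{v. a u v \<noteq> 0} \<subseteq> s" using off by blast
    ultimately show "p \<in> geometric_carrier (Pow s - {{}})"
      unfolding p a_mem using u by blast
  next
    fix p assume p: "p \<in> geometric_carrier (Pow s - {{}})"
    then have "{v. p v \<noteq> 0} \<subseteq> s" unfolding geometric_carrier_def by blast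
    then obtain u where "p = a u" using a_onto[OF p] by blast
    then show "p \<in> a ` {u. 0 \<le> Re u \<and> 0 \<le> Im u \<and> Re u + Im u \<le> 1}"
      using p a_mem by blast
  qed
  have opened: "a ` {u. 0 < Re u \<and> 0 < Im u \<and> Re u + Im u < 1} = geometric_carrier {s}"
  proof (rule set_eqI, rule iffI)
    fix p assume "p \<in> a ` {u. 0 < Re u \<and> 0 < Im u \<and> Re u + Im u < 1}"
    then obtain u where p: "p = a u" and u: "0 < Re u" "0 < Im u" "Re u + Im u < 1" by blast
    have "{v. a u v \<noteq> 0} = s"
    proof
      show "{v. a u v \<noteq> 0} \<subseteq> s" using off by blast
      show "s \<subseteq> {v. a u v \<noteq> 0}" unfolding s using u by (auto simp: at)
    qed
    then show "p \<in> geometric_carrier {s}" unfolding p a_mem using u by simp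
  next
    fix p assume p: "p \<in> geometric_carrier {s}"
    then have supp: "{v. p v \<noteq> 0} = s" unfolding geometric_carrier_def by blast
    then obtain u where u: "p = a u" using a_onto[OF p] by blast
    have "0 \<le> Re u \<and> 0 \<le> Im u \<and> Re u + Im u \<le> 1" using p a_mem unfolding u by blast
    moreover have "x \<in> {v. a u v \<noteq> 0}" "y \<in> {v. a u v \<noteq> 0}" "z \<in> {v. a u v \<noteq> 0}"
      using supp unfolding u s by auto
    then have "Re u \<noteq> 0" "Im u \<noteq> 0" "1 - Re u - Im u \<noteq> 0" by (auto simp: at)
    ultimately show "p \<in> a ` {u. 0 < Re u \<and> 0 < Im u \<and> Re u + Im u < 1}" using u by auto
  qed
  obtain g :: "complex \<Rightarrow> complex"
    where g: "continuous_on (cball 0 1) g" "inj_on g (cball 0 1)"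
      "g ` cball 0 1 = {u::complex. 0 \<le> Re u \<and> 0 \<le> Im u \<and> Re u + Im u \<le> 1}"
      "g ` ball 0 1 = {u::complex. 0 < Re u \<and> 0 < Im u \<and> Re u + Im u < 1}"
    using standard_triangle_disc by blast
  show thesis
  proof (rule that[of "a \<circ> g"])
    show "continuous_on (cball 0 1) (a \<circ> g)"
      using g(1) cont by (intro continuous_on_compose)
    show "inj_on (a \<circ> g) (cball 0 1)"
      using g(2) inj by (intro comp_inj_on) (auto intro: inj_on_subset)
  qed (simp_all only: image_comp[symmetric] g closed opened)
qed

text \<open>The carrier is a disjoint union of open simplices, so set operations on simplices pass to
  carriers.\<close>

lemma geometric_carrier_Un: "geometric_carrier (K \<union> L) = geometric_carrier K \<union> geometric_carrier L"
  and geometric_carrier_Int: "geometric_carrier (K \<inter> L) = geometric_carrier K \<inter> geometric_carrier L"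
  and geometric_carrier_Diff: "geometric_carrier (K - L) = geometric_carrier K - geometric_carrier L"
  unfolding geometric_carrier_def by blast+

lemma closed_geometric_carrier:
  fixes K :: "'v set set"
  assumes K: "simplicial_complex K"
  shows "closed (geometric_carrier K)"
proof -
  let ?S = "\<lambda>s :: 'v set. {x. (\<forall>v. 0 \<le> x v) \<and> (\<forall>v\<in>- s. x v = (0::real)) \<and> sum x s = 1}"
  have fin: "finite s" "s \<noteq> {}" if "s \<in> K" for s
    using that K unfolding simplicial_complex_def by auto
  have "geometric_carrier K = (\<Union>s\<in>K. ?S s)"
  proof (rule set_eqI, rule iffI)
    fix x assume "x \<in> geometric_carrier K"
    then show "x \<in> (\<Union>s\<in>K. ?S s)"
      unfolding geometric_carrier_def by (intro UN_I[of "{v. x v \<noteq> 0}"]) auto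
  next
    fix x assume "x \<in> (\<Union>s\<in>K. ?S s)"
    then obtain s where s: "s \<in> K" and x: "\<And>v. 0 \<le> x v" "\<And>v. v \<notin> s \<Longrightarrow> x v = 0" "sum x s = 1"
      by auto
    have "sum x {v. x v \<noteq> 0} = sum x s"
      by (rule sum.mono_neutral_left) (use fin[OF s] x(2) in auto)
    then have sum: "sum x {v. x v \<noteq> 0} = 1" using x(3) by simp
    then have "{v. x v \<noteq> 0} \<noteq> {}" by fastforce
    moreover have "{v. x v \<noteq> 0} \<subseteq> s" using x(2) by blast
    ultimately have "{v. x v \<noteq> 0} \<in> K" using K s unfolding simplicial_complex_def by blast
    then show "x \<in> geometric_carrier K" unfolding geometric_carrier_def using sum x(1) by blast
  qed
  moreover have "closed (?S s)" for s
    unfolding Ball_def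
    by (intro closed_Collect_conj closed_Collect_all closed_Collect_imp closed_Collect_le closed_Collect_eq
        continuous_intros continuous_on_product_coordinates open_Collect_const)
  moreover have "finite K" using K unfolding simplicial_complex_def by blast
  ultimately show ?thesis using closed_UN[of K ?S] by simp
qed

text \<open>Since the two complexes live on a common vertex type and share exactly the faces of the triangle,
  both embeddings of the punctured surfaces are inclusions, and one and the same disc is removed
  from both sides.\<close>

lemma connected_sum_along_triangle:
  fixes K L :: "nat set set"
  assumes K: "simplicial_complex (K - {s})" and L: "simplicial_complex (L - {s})"
    and KL: "K \<inter> L = Pow s - {{}}" and s: "card s = 3"
  shows "connected_sum (top_of_set (geometric_carrier K)) (top_of_set (geometric_carrier L))
    (top_of_set (geometric_carrier (K \<union> L - {s})))"
proof -
  let ?c = geometric_carrier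
  obtain e :: "complex \<Rightarrow> nat \<Rightarrow> real" where e: "continuous_on (cball 0 1) e" "inj_on e (cball 0 1)"
    "e ` cball 0 1 = ?c (Pow s - {{}})" "e ` ball 0 1 = ?c {s}"
    using triangle_carrier_disc[OF s] by blast
  have "sphere 0 1 = cball 0 1 - ball (0::complex) 1" by auto
  then have "e ` sphere 0 1 = e ` cball 0 1 - e ` ball 0 1"
    using e(2) by (metis ball_subset_cball inj_on_image_set_diff subset_refl Diff_subset)
  also have "\<dots> = ?c (K \<inter> L - {s})" unfolding e KL geometric_carrier_Diff ..
  also have "K \<inter> L - {s} = (K - {s}) \<inter> (L - {s})" by blast
  finally have sphere: "e ` sphere 0 1 = ?c (K - {s}) \<inter> ?c (L - {s})"
    unfolding geometric_carrier_Int .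
  have un: "K \<union> L - {s} = (K - {s}) \<union> (L - {s})" by blast
  have emb: "embedding_map (top_of_set (cball 0 1)) (top_of_set (?c M)) e" if "K \<inter> L \<subseteq> M" for M
  proof (rule embedding_map_compact_injective)
    have "?c (K \<inter> L) \<subseteq> ?c M" using that unfolding geometric_carrier_def by blast
    then show "e ` cball 0 1 \<subseteq> ?c M" unfolding e KL .
  qed (use e in auto)
  have id_emb: "embedding_map (subtopology (top_of_set (?c M)) (?c M - ?c {s})) (top_of_set (?c (K \<union> L - {s}))) id"
    if "M \<subseteq> K \<union> L" for M
  proof -
    have "?c M - ?c {s} \<subseteq> ?c (K \<union> L - {s})" using that unfolding geometric_carrier_def by blast
    then have "?c M \<inter> (?c M - ?c {s}) = ?c M - ?c {s}" "?c (K \<union> L - {s}) \<inter> (?c M - ?c {s}) = ?c M - ?c {s}"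
      by blast+
    then show ?thesis
      by (simp add: embedding_map_def subtopology_subtopology homeomorphic_map_id)
  qed
  show ?thesis
    unfolding connected_sum_def Let_def topspace_euclidean_subtopology
  proof (intro exI conjI)
    show "embedding_map (top_of_set (cball 0 1)) (top_of_set (?c K)) e"
      "embedding_map (top_of_set (cball 0 1)) (top_of_set (?c L)) e"
      by (rule emb, blast)+
    show "embedding_map (subtopology (top_of_set (?c K)) (?c K - e ` ball 0 1)) (top_of_set (?c (K \<union> L - {s}))) id"
      "embedding_map (subtopology (top_of_set (?c L)) (?c L - e ` ball 0 1)) (top_of_set (?c (K \<union> L - {s}))) id"
      unfolding e(4) by (rule id_emb, blast)+
    show "closedin (top_of_set (?c (K \<union> L - {s}))) (id ` (?c K - e ` ball 0 1))"
      "closedin (top_of_set (?c (K \<union> L - {s}))) (id ` (?c L - e ` ball 0 1))"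
      unfolding e(4) geometric_carrier_Diff[symmetric] un geometric_carrier_Un
      using K L by (auto intro!: closed_subset closed_geometric_carrier)
    show "id ` (?c K - e ` ball 0 1) \<union> id ` (?c L - e ` ball 0 1) = ?c (K \<union> L - {s})"
      unfolding e(4) un geometric_carrier_Un geometric_carrier_Diff by simp
    show "id ` (?c K - e ` ball 0 1) \<inter> id ` (?c L - e ` ball 0 1) = id ` e ` sphere 0 1"
      unfolding e(4) sphere geometric_carrier_Diff by simp
  qed simp
qed

lemma homeomorphic_map_imp_embedding_map: "homeomorphic_map X Y f \<Longrightarrow> embedding_map X Y f"
  using surjective_embedding_map by blast

text \<open>The disc in the second summand is carried along by the homeomorphism and the embedding of its
  complement is composed with the inverse.\<close>

lemma connected_sum_homeomorphic_right:
  assumes "connected_sum A B X" "B homeomorphic_space B'"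
  shows "connected_sum A B' X"
proof -
  obtain e e' p q where
      e: "embedding_map (top_of_set (cball (0::complex) 1)) A e"
    and e': "embedding_map (top_of_set (cball (0::complex) 1)) B e'"
    and p: "embedding_map (subtopology A (topspace A - e ` ball 0 1)) X p"
      "closedin X (p ` (topspace A - e ` ball 0 1))"
    and q: "embedding_map (subtopology B (topspace B - e' ` ball 0 1)) X q"
      "closedin X (q ` (topspace B - e' ` ball 0 1))"
    and cover: "p ` (topspace A - e ` ball 0 1) \<union> q ` (topspace B - e' ` ball 0 1) = topspace X"
      "p ` (topspace A - e ` ball 0 1) \<inter> q ` (topspace B - e' ` ball 0 1) = p ` e ` sphere 0 1"
    and glue: "\<And>z. z \<in> sphere 0 1 \<Longrightarrow> p (e z) = q (e' z)"
    using assms(1) unfolding connected_sum_def Let_def by blast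
  obtain h k where hk: "homeomorphic_maps B B' h k"
    using assms(2) unfolding homeomorphic_space_def by blast
  then have h: "homeomorphic_map B B' h" and k: "homeomorphic_map B' B k"
    and kh: "\<And>b. b \<in> topspace B \<Longrightarrow> k (h b) = b"
    using homeomorphic_maps_map by (blast, blast, simp add: homeomorphic_maps_def)
  have e'_sub: "e' ` cball 0 1 \<subseteq> topspace B"
    using e' by (simp add: embedding_map_def homeomorphic_eq_everything_map continuous_map_def)
      (metis embedding_map_def e' homeomorphic_imp_surjective_map inf_le1 topspace_euclidean_subtopology topspace_subtopology)
  let ?C = "topspace B - e' ` ball 0 1" and ?C' = "topspace B' - (h \<circ> e') ` ball 0 1"
  have hC: "h ` ?C = ?C'"
  proof -
    have "e' ` ball 0 1 \<subseteq> topspace B" using e'_sub ball_subset_cball[of 0 1] by blast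
    then have "h ` ?C = h ` topspace B - h ` e' ` ball 0 1"
      using h unfolding homeomorphic_map_def by (intro inj_on_image_set_diff) auto
    then show ?thesis using homeomorphic_imp_surjective_map[OF h] by (simp add: image_comp)
  qed
  have kC: "k ` ?C' = ?C"
    unfolding hC[symmetric] using kh by (force simp: image_iff)
  have qk: "(q \<circ> k) ` ?C' = q ` ?C" unfolding image_comp[of q k, symmetric] kC ..
  have "homeomorphic_map (subtopology B' ?C') (subtopology B ?C) k"
  proof (rule homeomorphic_map_subtopologies[OF k])
    have "topspace B' \<inter> ?C' = ?C'" "topspace B \<inter> ?C = ?C" by blast+
    then show "k ` (topspace B' \<inter> ?C') = topspace B \<inter> ?C" by (simp only: kC)
  qed
  then have "embedding_map (subtopology B' ?C') X (q \<circ> k)"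
    using q(1) by (intro embedding_map_compose) (rule homeomorphic_map_imp_embedding_map)
  moreover have "embedding_map (top_of_set (cball (0::complex) 1)) B' (h \<circ> e')"
    using e' h by (intro embedding_map_compose) (auto intro: homeomorphic_map_imp_embedding_map)
  moreover have "(q \<circ> k) ((h \<circ> e') z) = q (e' z)" if "z \<in> sphere 0 1" for z
    using kh[of "e' z"] e'_sub that by (simp add: image_subset_iff)
  ultimately show ?thesis
    unfolding connected_sum_def Let_def using e p q(2) cover glue qk
    by (intro exI[of _ e] exI[of _ "h \<circ> e'"] exI[of _ p] exI[of _ "q \<circ> k"]) simp
qed

text \<open>The connected sum of the carriers has the carrier of the second torus as a summand, whereas genus 2
  is defined with the standard torus; hence the transport along a homeomorphism.\<close>

lemma triangulated_genus_2_glue: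
  fixes P Q :: "nat \<Rightarrow> nat \<Rightarrow> nat \<Rightarrow> bool"
  assumes "triangle_gluing P Q x y z"
    and P: "triangulated_genus_surface 1 (triangle_complex P)"
    and Q: "triangulated_genus_surface 1 (triangle_complex Q)"
  shows "triangulated_genus_surface 2 (triangle_complex (glue {x, y, z} P Q))"
proof -
  interpret triangle_gluing P Q x y z by fact
  interpret swapped: triangle_gluing Q P y x z by (rule swap_gluing)
  interpret R: oriented_pseudomanifold "glue {x, y, z} P Q" by (rule oriented_pseudomanifold_glue)
  have "connected_sum (top_of_set (geometric_carrier (triangle_complex P)))
      (top_of_set (geometric_carrier (triangle_complex Q)))
      (top_of_set (geometric_carrier (triangle_complex (glue {x, y, z} P Q))))"
    unfolding triangle_complex_glue
  proof (rule connected_sum_along_triangle)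
    show "simplicial_complex (triangle_complex Q - {{x, y, z}})"
      using swapped.simplicial_complex_remove unfolding seam_eq .
    show "card {x, y, z} = 3" using distinct0 by simp
  qed (rule simplicial_complex_remove triangle_complex_Int)+
  then have "connected_sum (top_of_set (geometric_carrier (triangle_complex P))) torus_space
      (top_of_set (geometric_carrier (triangle_complex (glue {x, y, z} P Q))))"
    by (rule connected_sum_homeomorphic_right) (use Q in \<open>simp add: triangulated_genus_surface_def\<close>)
  moreover have "genus_surface (Suc 0) (top_of_set (geometric_carrier (triangle_complex P)))"
    using P by (simp add: triangulated_genus_surface_def)
  ultimately show ?thesis
    unfolding triangulated_genus_surface_def numeral_2_eq_2 genus_surface.simps using R.complex by blast
qed
section \<open>The cyclic triangulations of the torus\<close>

text \<open>Both maps are quotient maps, being continuous maps from a compact space to Hausdorff spaces, and a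
  quotient is determined by the identifications made.\<close>

lemma homeomorphic_images_if_same_kernel:
  fixes f :: "'a::metric_space \<Rightarrow> 'b::metric_space" and g :: "'a \<Rightarrow> 'c::metric_space"
  assumes S: "compact S" and f: "continuous_on S f" and g: "continuous_on S g"
    and ker: "\<And>u v. \<lbrakk>u \<in> S; v \<in> S\<rbrakk> \<Longrightarrow> f u = f v \<longleftrightarrow> g u = g v"
  shows "top_of_set (f ` S) homeomorphic_space top_of_set (g ` S)"
proof -
  have q: "quotient_map (top_of_set S) (top_of_set (f ` S)) f"
    using S f by (intro T1_Spaces.continuous_imp_quotient_map)
      (simp_all add: compact_space_subtopology Hausdorff_space_subtopology)
  obtain h where h: "continuous_map (top_of_set (f ` S)) (top_of_set (g ` S)) h"
      "h ` (f ` S) = g ` S" "\<And>x. x \<in> S \<Longrightarrow> h (f x) = g x"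
    by (rule quotient_map_lift_exists[OF q, of "top_of_set (g ` S)" g]) (use g ker in auto)
  have "homeomorphic_map (top_of_set (f ` S)) (top_of_set (g ` S)) h"
  proof (rule continuous_imp_homeomorphic_map[OF h(1)])
    show "compact_space (top_of_set (f ` S))"
      using compact_continuous_image[OF f S] by (simp add: compact_space_subtopology)
    show "Hausdorff_space (top_of_set (g ` S))"
      by (simp add: Hausdorff_space_subtopology)
    show "h ` topspace (top_of_set (f ` S)) = topspace (top_of_set (g ` S))"
      using h(2) by simp
    show "inj_on h (topspace (top_of_set (f ` S)))"
      using h(3) ker by (auto simp: inj_on_def)
  qed
  then show ?thesis
    using homeomorphic_map_imp_homeomorphic_space by blast
qed

text \<open>The link of the vertex \<open>i\<close> is the hexagon through \<open>i+1\<close>, \<open>i+3\<close>,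
  \<open>i+2\<close>, \<open>i-1\<close>, \<open>i-3\<close>, \<open>i-2\<close>; these are its directed
  edges.\<close>

abbreviation link_offsets :: "(int \<times> int) set" where
  "link_offsets \<equiv> {(1,3), (3,2), (2,-1), (-1,-3), (-3,-2), (-2,1)}"

text \<open>Labels by integers with period \<open>n\<close> replace arithmetic modulo \<open>n\<close> on the
  vertices, and they leave the names of the vertices free, which is needed for overlapping two tori
  in a prescribed triangle. All offsets within a triangle and its neighbours differ by less than 7,
  so for \<open>n \<ge> 7\<close> distinct offsets give distinct vertices.\<close>

locale cyclic_labelling =
  fixes n :: int and l :: "int \<Rightarrow> nat"
  assumes n7: "7 \<le> n" and label_eq_iff: "l i = l j \<longleftrightarrow> i mod n = j mod n"
begin

definition tri :: "nat \<Rightarrow> nat \<Rightarrow> nat \<Rightarrow> bool" where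
  "tri x y z \<longleftrightarrow> (\<exists>i. \<exists>(j, k) \<in> link_offsets.
     x = l i \<and> y = l (i + j) \<and> z = l (i + k))"

lemma label_shift: "l i = l j \<Longrightarrow> l (i + k) = l (j + k)"
  unfolding label_eq_iff by (rule mod_add_cong) simp_all

lemma label_offset_eq_iff: "\<bar>j - k\<bar> < 7 \<Longrightarrow> l (i + j) = l (i + k) \<longleftrightarrow> j = k"
proof -
  assume "\<bar>j - k\<bar> < 7"
  moreover have "l (i + j) = l (i + k) \<longleftrightarrow> n dvd j - k"
    by (simp add: label_eq_iff mod_eq_dvd_iff)
  moreover have "n dvd j - k \<Longrightarrow> j - k = 0"
    using dvd_imp_le_int[of "j - k" n] n7 calculation(1) by linarith
  ultimately show ?thesis by auto
qed

lemma label_offset_eq_base_iff: "\<bar>j\<bar> < 7 \<Longrightarrow> l (i + j) = l i \<longleftrightarrow> j = 0"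
  "\<bar>j\<bar> < 7 \<Longrightarrow> l i = l (i + j) \<longleftrightarrow> j = 0"
  using label_offset_eq_iff[of j 0 i] by auto

lemma triE:
  assumes "tri x y z"
  obtains i j k where "(j, k) \<in> link_offsets"
    "x = l i" "y = l (i + j)" "z = l (i + k)"
proof -
  from assms obtain i p where p: "p \<in> link_offsets"
    and xyz: "case p of (j, k) \<Rightarrow> x = l i \<and> y = l (i + j) \<and> z = l (i + k)"
    unfolding tri_def by (elim exE bexE)
  then show thesis using that[of "fst p" "snd p" i] by (simp add: case_prod_unfold)
qed

lemma tri_at:
  "(j, k) \<in> link_offsets \<Longrightarrow> tri (l i) (l (i + j)) (l (i + k))"
  unfolding tri_def by blast

lemma tri_upward: "tri (l i) (l (i + 1)) (l (i + 3))"
  unfolding tri_def by (rule exI[of _ i]) auto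

lemma tri_downward: "tri (l i) (l (i + 3)) (l (i + 2))"
  unfolding tri_def by (rule exI[of _ i]) auto

lemma tri_cases:
  assumes "tri x y z"
  obtains i where "(x, y, z) \<in> {(l i, l (i + 1), l (i + 3)), (l (i + 1), l (i + 3), l i), (l (i + 3), l i, l (i + 1))}"
    | i where "(x, y, z) \<in> {(l i, l (i + 3), l (i + 2)), (l (i + 3), l (i + 2), l i), (l (i + 2), l i, l (i + 3))}"
proof -
  obtain i j k where jk: "(j, k) \<in> link_offsets"
    and xyz: "x = l i" "y = l (i + j)" "z = l (i + k)"
    by (rule triE[OF assms])
  from jk consider "j = 1" "k = 3" | "j = 3" "k = 2" | "j = 2" "k = -1" | "j = -1" "k = -3"
    | "j = -3" "k = -2" | "j = -2" "k = 1" by auto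
  then show thesis
  proof cases
    case 1 then show thesis using that(1)[of i] xyz by simp
  next
    case 2 then show thesis using that(2)[of i] xyz by simp
  next
    case 3 then show thesis using that(1)[of "i - 1"] xyz by (simp add: add.commute)
  next
    case 4 then show thesis using that(2)[of "i - 3"] xyz by simp
  next
    case 5 then show thesis using that(1)[of "i - 3"] xyz by simp
  next
    case 6 then show thesis using that(2)[of "i - 2"] xyz by (simp add: add.commute)
  qed
qed

lemma tri_complex_iff:
  "s \<in> triangle_complex tri \<longleftrightarrow>
     s \<noteq> {} \<and> (\<exists>i. s \<subseteq> {l i, l (i + 1), l (i + 3)} \<or> s \<subseteq> {l i, l (i + 2), l (i + 3)})"
proof -
  have "\<exists>i. s \<subseteq> {l i, l (i + 1), l (i + 3)} \<or> s \<subseteq> {l i, l (i + 2), l (i + 3)}"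
    if "tri x y z" "s \<subseteq> {x, y, z}" for x y z
    using that(1)
  proof (cases rule: tri_cases)
    case (1 i)
    then have "s \<subseteq> {l i, l (i + 1), l (i + 3)}" using that(2) by auto
    then show ?thesis by blast
  next
    case (2 i)
    then have "s \<subseteq> {l i, l (i + 2), l (i + 3)}" using that(2) by auto
    then show ?thesis by blast
  qed
  moreover have "\<exists>x y z. tri x y z \<and> s \<subseteq> {x, y, z}" if "s \<subseteq> {l i, l (i + 1), l (i + 3)}" for i
    using that tri_upward by blast
  moreover have "\<exists>x y z. tri x y z \<and> s \<subseteq> {x, y, z}" if "s \<subseteq> {l i, l (i + 2), l (i + 3)}" for i
    using that tri_downward[of i] by blast
  ultimately show ?thesis
    unfolding triangle_complex_def by blast
qed

text \<open>The unit square at the lattice point labelled \<open>i\<close> has corners \<open>i\<close>,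
  \<open>i+1\<close>, \<open>i+2\<close> and \<open>i+3\<close> at \<open>(0, 0)\<close>, \<open>(1, 0)\<close>,
  \<open>(0, 1)\<close> and \<open>(1, 1)\<close> and is cut along the diagonal from \<open>i\<close> to
  \<open>i+3\<close>. These are the barycentric coordinates of the point \<open>(f, g)\<close>, in one
  formula for both halves.\<close>

definition cell_point :: "int \<Rightarrow> real \<Rightarrow> real \<Rightarrow> nat \<Rightarrow> real" where
  "cell_point i f g v =
     (1 - max f g) * of_bool (v = l i) + max 0 (f - g) * of_bool (v = l (i + 1))
     + max 0 (g - f) * of_bool (v = l (i + 2)) + min f g * of_bool (v = l (i + 3))"

lemma cell_point_at:
  "cell_point i f g (l i) = 1 - max f g"
  "cell_point i f g (l (i + 1)) = max 0 (f - g)"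
  "cell_point i f g (l (i + 2)) = max 0 (g - f)"
  "cell_point i f g (l (i + 3)) = min f g"
  unfolding cell_point_def by (simp_all add: label_offset_eq_iff label_offset_eq_base_iff)

lemma cell_point_support:
  "cell_point i f g v \<noteq> 0 \<Longrightarrow> v \<in> {l i, l (i + 1), l (i + 2), l (i + 3)}"
  unfolding cell_point_def by (auto split: if_splits)

lemma cell_point_edges:
  "0 \<le> g \<Longrightarrow> g \<le> 1 \<Longrightarrow> cell_point i 1 g = cell_point (i + 1) 0 g"
  "0 \<le> f \<Longrightarrow> f \<le> 1 \<Longrightarrow> cell_point i f 1 = cell_point (i + 2) f 0"
  unfolding cell_point_def by (auto simp: max_def min_def fun_eq_iff algebra_simps)

lemma cell_point_in_carrier:
  assumes "0 \<le> f" "f \<le> 1" "0 \<le> g" "g \<le> 1"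
  shows "cell_point i f g \<in> geometric_carrier (triangle_complex tri)"
proof -
  let ?D = "{v. cell_point i f g v \<noteq> 0}" and ?B = "{l i, l (i + 1), l (i + 2), l (i + 3)}"
  have "(\<Sum>v\<in>?D. cell_point i f g v) = (\<Sum>v\<in>?B. cell_point i f g v)"
    by (rule sum.mono_neutral_left) (use cell_point_support in auto)
  also have "\<dots> = 1"
    by (simp add: label_offset_eq_iff label_offset_eq_base_iff cell_point_at)
  finally have sum: "(\<Sum>v\<in>?D. cell_point i f g v) = 1" .
  have "?D \<subseteq> {l i, l (i + 1), l (i + 3)} \<or> ?D \<subseteq> {l i, l (i + 2), l (i + 3)}"
  proof (cases "g \<le> f")
    case True
    have "?D \<subseteq> {l i, l (i + 1), l (i + 3)}"
      using cell_point_support[of i f g] cell_point_at(3)[of i f g] True by fastforce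
    then show ?thesis ..
  next
    case False
    have "?D \<subseteq> {l i, l (i + 2), l (i + 3)}"
      using cell_point_support[of i f g] cell_point_at(2)[of i f g] False by fastforce
    then show ?thesis ..
  qed
  moreover have "?D \<noteq> {}"
    using sum by fastforce
  ultimately have "?D \<in> triangle_complex tri"
    unfolding tri_complex_iff by blast
  moreover have "0 \<le> cell_point i f g v" for v
    using assms unfolding cell_point_def by (intro add_nonneg_nonneg mult_nonneg_nonneg) auto
  ultimately show ?thesis
    using sum unfolding geometric_carrier_def by blast
qed

lemma carrier_subset_cell_points:
  assumes "p \<in> geometric_carrier (triangle_complex tri)"
  obtains i f g where "0 \<le> f" "f \<le> 1" "0 \<le> g" "g \<le> 1" "p = cell_point i f g"
proof -
  let ?D = "{v. p v \<noteq> 0}"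
  have p: "\<And>v. 0 \<le> p v" "?D \<in> triangle_complex tri" "sum p ?D = 1"
    using assms unfolding geometric_carrier_def by auto
  obtain i where "?D \<subseteq> {l i, l (i + 1), l (i + 3)} \<or> ?D \<subseteq> {l i, l (i + 2), l (i + 3)}"
    using p(2) unfolding tri_complex_iff by blast
  then consider "?D \<subseteq> {l i, l (i + 1), l (i + 3)}" | "?D \<subseteq> {l i, l (i + 2), l (i + 3)}"
    by blast
  then show thesis
  proof cases
    case 1
    have "sum p ?D = sum p {l i, l (i + 1), l (i + 3)}"
      by (rule sum.mono_neutral_left) (use 1 in auto)
    then have s: "p (l i) + p (l (i + 1)) + p (l (i + 3)) = 1"
      using p(3) by (simp add: label_offset_eq_iff label_offset_eq_base_iff)
    let ?f = "p (l (i + 1)) + p (l (i + 3))" and ?g = "p (l (i + 3))"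
    have "p v = cell_point i ?f ?g v" for v
    proof (cases "v \<in> {l i, l (i + 1), l (i + 3)}")
      case True
      then show ?thesis using s p(1)[of "l (i + 1)"] by (auto simp: cell_point_at)
    next
      case False
      then have "p v = 0" using 1 by auto
      moreover have "max 0 (?g - ?f) = 0" using p(1)[of "l (i + 1)"] by simp
      ultimately show ?thesis using False by (simp add: cell_point_def)
    qed
    then have "p = cell_point i ?f ?g" by (rule ext)
    then show thesis
      by (rule that[rotated -1]) (use s p(1)[of "l i"] p(1)[of "l (i + 1)"] p(1)[of "l (i + 3)"] in linarith)+
  next
    case 2
    have "sum p ?D = sum p {l i, l (i + 2), l (i + 3)}"
      by (rule sum.mono_neutral_left) (use 2 in auto)
    then have s: "p (l i) + p (l (i + 2)) + p (l (i + 3)) = 1"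
      using p(3) by (simp add: label_offset_eq_iff label_offset_eq_base_iff)
    let ?g = "p (l (i + 2)) + p (l (i + 3))" and ?f = "p (l (i + 3))"
    have "p v = cell_point i ?f ?g v" for v
    proof (cases "v \<in> {l i, l (i + 2), l (i + 3)}")
      case True
      then show ?thesis using s p(1)[of "l (i + 2)"] by (auto simp: cell_point_at)
    next
      case False
      then have "p v = 0" using 2 by auto
      moreover have "max 0 (?f - ?g) = 0" using p(1)[of "l (i + 2)"] by simp
      ultimately show ?thesis using False by (simp add: cell_point_def)
    qed
    then have "p = cell_point i ?f ?g" by (rule ext)
    then show thesis
      by (rule that[rotated -1]) (use s p(1)[of "l i"] p(1)[of "l (i + 2)"] p(1)[of "l (i + 3)"] in linarith)+
  qed
qed

text \<open>On the half-open square the coordinate at the corner \<open>i\<close> is positive. So two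
  representations of a point have each other's corner in their support, at offsets between 0 and 3;
  the two offsets add up to a multiple of \<open>n\<close> that is at most 6, hence both vanish.\<close>

lemma cell_point_inj:
  assumes "0 \<le> f" "f < 1" "0 \<le> g" "g < 1" "0 \<le> f'" "f' < 1" "0 \<le> g'" "g' < 1"
    and eq: "cell_point i f g = cell_point i' f' g'"
  shows "l i = l i' \<and> f = f' \<and> g = g'"
proof -
  have "cell_point i' f' g' (l i) \<noteq> 0"
    unfolding eq[symmetric] cell_point_at using assms by simp
  then obtain j where j: "l i = l (i' + j)" "0 \<le> j" "j \<le> 3"
    using cell_point_support[of i' f' g' "l i"] that[of 0] that[of 1] that[of 2] that[of 3] by auto
  have "cell_point i f g (l i') \<noteq> 0"
    unfolding eq cell_point_at using assms by simp
  then obtain j' where j': "l i' = l (i + j')" "0 \<le> j'" "j' \<le> 3"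
    using cell_point_support[of i f g "l i'"] that[of 0] that[of 1] that[of 2] that[of 3] by auto
  have "l i = l (i' + j)" by (rule j)
  also have "\<dots> = l (i + j' + j)" by (rule label_shift[OF j'(1)])
  finally have "l i = l (i + (j + j'))" by (simp add: ac_simps)
  then have "j + j' = 0"
    using label_offset_eq_base_iff(2)[of "j + j'" i] j j' by simp
  then have "j = 0" using j j' by linarith
  then have ii': "l i = l i'" using j by simp
  then have shift: "l (i + k) = l (i' + k)" for k by (rule label_shift)
  have "cell_point i f g (l (i + k)) = cell_point i' f' g' (l (i' + k))" for k
    using eq shift by simp
  from this[of 0] this[of 1] this[of 2] this[of 3]
  have "1 - max f g = 1 - max f' g'" "max 0 (f - g) = max 0 (f' - g')"
    "max 0 (g - f) = max 0 (g' - f')" "min f g = min f' g'"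
    by (simp_all add: cell_point_at)
  then show ?thesis using ii' by linarith
qed

text \<open>The covering of the carrier by the plane, and the covering of the standard torus with the same
  group of deck translations: the label \<open>x + 2 y\<close> modulo \<open>n\<close> and the height
  \<open>y\<close> modulo 1 are the two angles.\<close>

definition unroll :: "real \<times> real \<Rightarrow> nat \<Rightarrow> real" where
  "unroll u = cell_point (\<lfloor>fst u\<rfloor> + 2 * \<lfloor>snd u\<rfloor>) (frac (fst u)) (frac (snd u))"

definition wrap :: "real \<times> real \<Rightarrow> complex \<times> complex" where
  "wrap u = (cis (2 * pi * ((fst u + 2 * snd u) / n)), cis (2 * pi * snd u))"

lemma cis_2pi_eq_iff: "cis (2 * pi * x) = cis (2 * pi * y) \<longleftrightarrow> x - y \<in> \<int>"
proof -
  have "cis (2 * pi * x) = cis (2 * pi * y) \<longleftrightarrow> cis (2 * pi * (x - y)) = 1"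
    by (metis cis_divide cis_neq_zero divide_eq_1_iff right_diff_distrib)
  also have "\<dots> \<longleftrightarrow> x - y \<in> \<int>"
  proof -
    have "cis (2 * pi * (x - y)) = 1 \<longleftrightarrow> (\<exists>k. 2 * pi * (x - y) = of_int (2 * k) * pi)"
      unfolding cis_conv_exp exp_eq_1 by simp
    also have "\<dots> \<longleftrightarrow> (\<exists>k. x - y = of_int k)" by simp
    finally show ?thesis by (auto simp: Ints_def)
  qed
  finally show ?thesis .
qed

lemma unroll_eq_iff_wrap_eq: "unroll u = unroll v \<longleftrightarrow> wrap u = wrap v"
proof -
  obtain x y x' y' where uv: "u = (x, y)" "v = (x', y')" by fastforce
  let ?i = "\<lfloor>x\<rfloor> + 2 * \<lfloor>y\<rfloor>" and ?i' = "\<lfloor>x'\<rfloor> + 2 * \<lfloor>y'\<rfloor>"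
  have "unroll u = unroll v \<longleftrightarrow> l ?i = l ?i' \<and> frac x = frac x' \<and> frac y = frac y'"
  proof
    assume "unroll u = unroll v"
    then show "l ?i = l ?i' \<and> frac x = frac x' \<and> frac y = frac y'"
      unfolding uv unroll_def by (intro cell_point_inj) (auto simp: frac_ge_0 frac_lt_1)
  next
    assume *: "l ?i = l ?i' \<and> frac x = frac x' \<and> frac y = frac y'"
    then have "l (?i + k) = l (?i' + k)" for k by (blast intro: label_shift)
    with * show "unroll u = unroll v"
      unfolding uv unroll_def cell_point_def by (simp add: fun_eq_iff)
  qed
  also have "\<dots> \<longleftrightarrow> (\<exists>k::int. ?i - ?i' = n * k) \<and> frac x = frac x' \<and> frac y = frac y'"
    by (auto simp: label_eq_iff mod_eq_dvd_iff dvd_def)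
  also have "\<dots> \<longleftrightarrow> (x + 2 * y) / n - (x' + 2 * y') / n \<in> \<int> \<and> y - y' \<in> \<int>"
  proof safe
    fix k assume k: "?i - ?i' = n * k" and fr: "frac x = frac x'" "frac y = frac y'"
    have "(x + 2 * y) - (x' + 2 * y') = of_int (?i - ?i')"
      using fr unfolding frac_def by simp
    also have "\<dots> = n * k" using k by simp
    finally have "(x + 2 * y) / n - (x' + 2 * y') / n = k"
      using n7 by (simp add: field_simps)
    then show "(x + 2 * y) / n - (x' + 2 * y') / n \<in> \<int>" by simp
    have "y - y' = of_int (\<lfloor>y\<rfloor> - \<lfloor>y'\<rfloor>)" using fr unfolding frac_def by simp
    then show "y - y' \<in> \<int>" by (metis Ints_of_int)
  next
    assume "(x + 2 * y) / n - (x' + 2 * y') / n \<in> \<int>" "y - y' \<in> \<int>"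
    then obtain k m where k: "(x + 2 * y) / n - (x' + 2 * y') / n = of_int k"
      and m: "y - y' = of_int m" by (auto elim!: Ints_cases)
    have ym: "y = y' + of_int m" using m by simp
    then have y: "frac y = frac y'" "\<lfloor>y\<rfloor> = \<lfloor>y'\<rfloor> + m" by (auto simp: frac_def)
    have "((x + 2 * y) - (x' + 2 * y')) / n = k"
      using k by (simp add: diff_divide_distrib)
    then have "(x + 2 * y) - (x' + 2 * y') = n * k"
      using n7 by (simp add: divide_eq_eq mult.commute)
    then have xk: "x = x' + of_int (n * k - 2 * m)" using ym by simp
    then have floor: "\<lfloor>x\<rfloor> = \<lfloor>x'\<rfloor> + (n * k - 2 * m)"
      by (simp only: floor_add_int)
    then have "frac x = frac x'"
      using xk by (simp add: frac_def)
    then show "frac x = frac x'" "frac y = frac y'" "\<exists>k. ?i - ?i' = n * k"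
      using y floor by auto
  qed
  also have "\<dots> \<longleftrightarrow> wrap u = wrap v"
    unfolding uv wrap_def prod.inject fst_conv snd_conv cis_2pi_eq_iff ..
  finally show ?thesis .
qed

text \<open>The formula of a closed cell also holds on its upper and right sides, where the integer parts
  jump, because neighbouring cells agree on their common edge. This is what continuity rests on.\<close>

lemma unroll_eq_cell_point:
  assumes "of_int i \<le> x" "x \<le> of_int i + 1" "0 \<le> y" "y \<le> 1"
  shows "unroll (x, y) = cell_point i (x - of_int i) y"
proof -
  have x: "cell_point (\<lfloor>x\<rfloor> + k) (frac x) g = cell_point (i + k) (x - of_int i) g" if "0 \<le> g" "g \<le> 1" for k g
  proof (cases "x = of_int i + 1")
    case True
    then show ?thesis using cell_point_edges(1)[OF that, of "i + k"] by (simp add: frac_def ac_simps)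
  next
    case False
    then have "\<lfloor>x\<rfloor> = i" using assms by (intro floor_unique) auto
    then show ?thesis by (simp add: frac_def)
  qed
  show ?thesis
  proof (cases "y = 1")
    case True
    then show ?thesis
      using x[of 0 2] cell_point_edges(2)[of "x - of_int i" i] assms by (simp add: unroll_def)
  next
    case False
    then have "\<lfloor>y\<rfloor> = 0" using assms by (intro floor_unique) auto
    then show ?thesis using x[of y 0] assms by (simp add: unroll_def frac_def)
  qed
qed

definition strip :: "(real \<times> real) set" where
  "strip = {0..of_int n} \<times> {0..1}"

lemma strip_eq_Union_cells: "strip = (\<Union>i\<in>{0..<n}. {of_int i..of_int i + 1} \<times> {0..1})"
proof -
  have "{0..real_of_int n} = (\<Union>i\<in>{0..<n}. {of_int i..of_int i + 1})"
  proof (intro set_eqI iffI)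
    fix x assume x: "x \<in> {0..real_of_int n}"
    show "x \<in> (\<Union>i\<in>{0..<n}. {of_int i..of_int i + 1})"
    proof (cases "x = of_int n")
      case True
      then show ?thesis using n7 by (intro UN_I[of "n - 1"]) auto
    next
      case False
      then have "\<lfloor>x\<rfloor> \<in> {0..<n}" using x by (simp add: floor_less_iff)
      then show ?thesis by (intro UN_I[of "\<lfloor>x\<rfloor>"]) (auto intro: order_less_imp_le)
    qed
  next
    fix x assume "x \<in> (\<Union>i\<in>{0..<n}. {real_of_int i..of_int i + 1})"
    then obtain i where i: "0 \<le> i" "i < n" "real_of_int i \<le> x" "x \<le> of_int i + 1" by auto
    then have "real_of_int i + 1 \<le> of_int n" "0 \<le> real_of_int i" by (simp_all add: int_less_real_le)
    then show "x \<in> {0..real_of_int n}" using i by simp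
  qed
  then show ?thesis unfolding strip_def by auto
qed

lemma continuous_on_unroll: "continuous_on strip unroll"
  unfolding strip_eq_Union_cells
proof (rule continuous_on_closed_Union)
  fix i assume "i \<in> {0..<n}"
  show "closed ({real_of_int i..of_int i + 1} \<times> {0..1::real})" by (intro closed_Times) auto
  have "continuous_on ({real_of_int i..of_int i + 1} \<times> {0..1})
      (\<lambda>u. cell_point i (fst u - of_int i) (snd u))"
    unfolding cell_point_def by (intro continuous_intros)
  then show "continuous_on ({real_of_int i..of_int i + 1} \<times> {0..1}) unroll"
    by (rule continuous_on_eq) (auto simp: unroll_eq_cell_point)
qed simp

lemma unroll_image: "unroll ` strip = geometric_carrier (triangle_complex tri)"
proof (intro set_eqI iffI)
  fix p assume "p \<in> unroll ` strip"
  then show "p \<in> geometric_carrier (triangle_complex tri)"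
    unfolding unroll_def
    by (auto intro!: cell_point_in_carrier simp: less_imp_le[OF frac_lt_1])
next
  fix p assume "p \<in> geometric_carrier (triangle_complex tri)"
  then obtain i f g where fg: "0 \<le> f" "f \<le> 1" "0 \<le> g" "g \<le> 1" and p: "p = cell_point i f g"
    by (rule carrier_subset_cell_points)
  let ?i = "i mod n"
  have "l (?i + k) = l (i + k)" for k by (simp add: label_eq_iff mod_add_left_eq)
  from this[of 0] this have "p = cell_point ?i f g"
    unfolding p cell_point_def by simp
  also have "\<dots> = unroll (of_int ?i + f, g)"
    using unroll_eq_cell_point[of ?i "of_int ?i + f" g] fg by simp
  finally have "p = unroll (of_int ?i + f, g)" .
  moreover have "(of_int ?i + f, g) \<in> strip"
    unfolding strip_eq_Union_cells using fg n7
    by (intro UN_I[of ?i]) auto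
  ultimately show "p \<in> unroll ` strip" by (rule image_eqI)
qed

lemma wrap_image: "wrap ` strip = sphere 0 1 \<times> sphere 0 1"
proof (rule set_eqI, rule iffI)
  fix w assume "w \<in> wrap ` strip"
  then obtain u where "w = wrap u" by blast
  then show "w \<in> sphere 0 1 \<times> sphere 0 1"
    by (simp add: wrap_def)
next
  fix w :: "complex \<times> complex" assume w: "w \<in> sphere 0 1 \<times> sphere 0 1"
  have ex: "\<exists>t. c = cis (2 * pi * t)" if "c \<in> sphere 0 1" for c
  proof -
    have "c = cis (2 * pi * (Arg c / (2 * pi)))"
      using that rcis_cmod_Arg[of c] by (simp add: rcis_def)
    then show ?thesis by blast
  qed
  obtain s t where st: "w = (cis (2 * pi * s), cis (2 * pi * t))"
    using ex[of "fst w"] ex[of "snd w"] w by (cases w) auto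
  have n0: "real_of_int n > 0" using n7 by simp
  define y where "y = frac t"
  define r where "r = frac (s - 2 * y / n)"
  have y: "0 \<le> y" "y < 1" "y - t \<in> \<int>" by (simp_all add: y_def frac_lt_1) (simp add: frac_def)
  have r: "0 \<le> r" "r < 1" "r - (s - 2 * y / n) \<in> \<int>" by (simp_all add: r_def frac_lt_1) (simp add: frac_def)
  have "(of_int n * r + 2 * y) / n - s = r - (s - 2 * y / n)"
    using n0 by (simp add: add_divide_distrib)
  then have "(of_int n * r + 2 * y) / n - s \<in> \<int>" using r(3) by (simp only:)
  then have "wrap (of_int n * r, y) = w"
    unfolding st wrap_def prod.inject fst_conv snd_conv cis_2pi_eq_iff using y(3) by blast
  moreover have "(of_int n * r, y) \<in> strip"
    using n0 r y mult_left_mono[of r 1 "of_int n"] by (simp add: strip_def)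
  ultimately show "w \<in> wrap ` strip" by (rule image_eqI[OF sym])
qed

text \<open>Both coverings are onto already from the strip, which is compact, and they make the same
  identifications.\<close>

lemma carrier_homeomorphic_torus:
  "top_of_set (geometric_carrier (triangle_complex tri)) homeomorphic_space torus_space"
proof -
  have "continuous_on strip wrap"
    unfolding wrap_def by (intro continuous_intros) (use n7 in auto)
  moreover have "compact strip" unfolding strip_def by (intro compact_Times) auto
  ultimately have "top_of_set (unroll ` strip) homeomorphic_space top_of_set (wrap ` strip)"
    by (intro homeomorphic_images_if_same_kernel continuous_on_unroll unroll_eq_iff_wrap_eq)
  moreover have "torus_space = top_of_set (sphere 0 1 \<times> sphere 0 1)"
    unfolding torus_space_def by (simp flip: subtopology_Times)
  ultimately show ?thesis unfolding unroll_image wrap_image by simp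
qed

end

context cyclic_labelling
begin

lemma tri_rotate: "tri x y z \<Longrightarrow> tri y z x"
proof -
  assume "tri x y z"
  then obtain i j k where jk: "(j, k) \<in> link_offsets"
    and xyz: "x = l i" "y = l (i + j)" "z = l (i + k)"
    by (rule triE)
  have "(k - j, - j) \<in> link_offsets"
    using jk by auto
  from tri_at[OF this, of "i + j"] show "tri y z x" unfolding xyz by (simp add: algebra_simps)
qed

lemma label_mod: "l (i mod n) = l i"
  by (simp add: label_eq_iff)

lemma tri_base:
  assumes "tri (l i) y z"
  obtains j k where "(j, k) \<in> link_offsets"
    "y = l (i + j)" "z = l (i + k)"
proof -
  obtain i' j k where jk: "(j, k) \<in> link_offsets"
    and xyz: "l i = l i'" "y = l (i' + j)" "z = l (i' + k)"
    by (rule triE[OF assms])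
  then show thesis using that[of j k] label_shift[OF xyz(1)] by simp
qed

lemma tri_opposite_offsets:
  assumes "tri (l i) (l (i + j)) z" "tri (l (i + j)) (l i) w" "\<bar>j\<bar> \<le> 3"
  obtains k k' where "(j, k) \<in> link_offsets" "z = l (i + k)"
    "(- j, k') \<in> link_offsets" "w = l (i + j + k')"
proof -
  obtain j1 k where 1: "(j1, k) \<in> link_offsets"
    "l (i + j) = l (i + j1)" "z = l (i + k)" by (rule tri_base[OF assms(1)])
  obtain j2 k' where 2: "(j2, k') \<in> link_offsets"
    "l i = l (i + j + j2)" "w = l (i + j + k')" by (rule tri_base[OF assms(2)])
  have "\<bar>j - j1\<bar> < 7" "\<bar>j + j2\<bar> < 7" using 1(1) 2(1) assms(3) by auto
  then have "j = j1" "j2 = - j"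
    using 1(2) 2(2) label_offset_eq_iff[of j j1 i] label_offset_eq_base_iff(2)[of "j + j2" i]
    by (simp_all add: add.assoc)
  then show thesis using that[of k k'] 1 2 by blast
qed

text \<open>The triangles form a cycle in which each shares an edge with the next: the upward triangle at
  \<open>i\<close> with the downward one at \<open>i\<close> (edge \<open>{i, i+3}\<close>) and the
  downward one at \<open>i+1\<close> (edge \<open>{i+1, i+3}\<close>). Without one upward triangle the
  cycle becomes a path through all the others.\<close>

lemma edge_connected_remove:
  "edge_connected (remove_triangle {l c, l (c + 1), l (c + 3)} tri)" (is "edge_connected ?P")
proof -
  note offs = label_offset_eq_iff label_offset_eq_base_iff
  have shift: "l (c + k) = l (i + (s + k))" if "l c = l (i + s)" for i s k
    using label_shift[OF that, of k] by (simp only: add.assoc)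
  have up: "?P (l i) (l (i + 1)) (l (i + 3))" if i: "l i \<noteq> l c" for i
  proof -
    have "{l i, l (i + 1), l (i + 3)} \<noteq> {l c, l (c + 1), l (c + 3)}"
    proof
      assume eq: "{l i, l (i + 1), l (i + 3)} = {l c, l (c + 1), l (c + 3)}"
      have "l c \<in> {l i, l (i + 1), l (i + 3)}" and c1: "l (c + 1) \<in> {l i, l (i + 1), l (i + 3)}"
        unfolding eq by auto
      then have c: "l c = l (i + 1) \<or> l c = l (i + 3)" using i by auto
      from c show False
      proof
        assume "l c = l (i + 1)"
        from shift[OF this, of 1] c1 show False by (simp add: offs)
      next
        assume "l c = l (i + 3)"
        from shift[OF this, of 1] c1 show False by (simp add: offs)
      qed
    qed
    then show ?thesis using tri_upward by (simp add: remove_triangle_def)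
  qed
  have down: "?P (l i) (l (i + 3)) (l (i + 2))" for i
  proof -
    have "{l i, l (i + 3), l (i + 2)} \<noteq> {l c, l (c + 1), l (c + 3)}"
    proof
      assume eq: "{l i, l (i + 3), l (i + 2)} = {l c, l (c + 1), l (c + 3)}"
      have "l c \<in> {l i, l (i + 3), l (i + 2)}" unfolding eq by auto
      then consider "l c = l (i + 0)" | "l c = l (i + 2)" | "l c = l (i + 3)" by auto
      moreover have c1: "l (c + 1) \<in> {l i, l (i + 3), l (i + 2)}" and c3: "l (c + 3) \<in> {l i, l (i + 3), l (i + 2)}"
        unfolding eq by auto
      ultimately show False
      proof cases
        case 1 from shift[OF this, of 1] c1 show False by (simp add: offs)
      next
        case 2 from shift[OF this, of 3] c3 show False by (simp add: offs)
      next
        case 3 from shift[OF this, of 1] c1 show False by (simp add: offs)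
      qed
    qed
    then show ?thesis using tri_downward by (simp add: remove_triangle_def)
  qed
  have rotP: "?P y z x" if "?P x y z" for x y z
  proof -
    have "{y, z, x} = {x, y, z}" by blast
    then show ?thesis using that tri_rotate[of x y z] by (simp add: remove_triangle_def)
  qed
  show ?thesis
    unfolding edge_connected_def
  proof (intro allI impI)
    fix r :: "nat \<Rightarrow> nat \<Rightarrow> nat \<Rightarrow> int"
    assume "\<forall>x y z. ?P x y z \<longrightarrow> r y z x = r x y z"
      and "\<forall>x y z w. ?P x y z \<longrightarrow> ?P y x w \<longrightarrow> r x y z = r y x w"
    then have rot: "\<And>x y z. ?P x y z \<Longrightarrow> r y z x = r x y z"
      and cross: "\<And>x y z w. ?P x y z \<Longrightarrow> ?P y x w \<Longrightarrow> r x y z = r y x w" by blast+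
    let ?A = "\<lambda>i. r (l i) (l (i + 1)) (l (i + 3))" and ?B = "\<lambda>i. r (l i) (l (i + 3)) (l (i + 2))"
    have AB: "?A i = ?B i" if i: "l i \<noteq> l c" for i
    proof -
      note u = up[OF i] and u' = rotP[OF up[OF i]] and u'' = rotP[OF rotP[OF up[OF i]]]
      have "?A i = r (l (i + 3)) (l i) (l (i + 1))" using rot[OF u] rot[OF u'] by simp
      also have "\<dots> = ?B i" by (rule cross[OF u'' down])
      finally show ?thesis .
    qed
    have AB': "?A i = ?B (i + 1)" if i: "l i \<noteq> l c" for i
    proof -
      note u = up[OF i] and u' = rotP[OF up[OF i]]
      have d: "?P (l (i + 1)) (l (i + 4)) (l (i + 3))" using down[of "i + 1"] by (simp add: add.assoc)
      note d' = rotP[OF d] and d'' = rotP[OF rotP[OF d]]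
      have "?A i = r (l (i + 1)) (l (i + 3)) (l i)" using rot[OF u] by simp
      also have "\<dots> = r (l (i + 3)) (l (i + 1)) (l (i + 4))" by (rule cross[OF u' d''])
      also have "\<dots> = ?B (i + 1)" using rot[OF d] rot[OF d'] by (simp add: add.assoc)
      finally show ?thesis .
    qed
    \<comment> \<open>Starting behind the removed triangle, the path reaches it again only after a full turn.\<close>
    have walk: "int m < n \<Longrightarrow> ?B (c + 1 + int m) = ?B (c + 1)" for m
    proof (induction m)
      case (Suc m)
      let ?i = "c + 1 + int m"
      have "\<not> n dvd 1 + int m" using Suc.prems zdvd_imp_le[of n "1 + int m"] by auto
      then have ne: "l ?i \<noteq> l c" by (simp add: label_eq_iff mod_eq_dvd_iff add.assoc)
      have "?B (?i + 1) = ?B ?i" by (rule trans[OF AB'[OF ne, symmetric] AB[OF ne]])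
      also have "\<dots> = ?B (c + 1)" using Suc by simp
      finally have "?B (?i + 1) = ?B (c + 1)" .
      moreover have "?i + 1 = c + 1 + int (Suc m)" by simp
      ultimately show ?case by (simp only:)
    qed simp
    have B: "?B i = ?B (c + 1)" for i
    proof -
      let ?m = "nat ((i - c - 1) mod n)"
      have m: "int ?m = (i - c - 1) mod n" "int ?m < n" using n7 by simp_all
      have "l i = l (c + 1 + int ?m)"
        unfolding m(1) label_eq_iff by (simp add: mod_add_right_eq)
      from label_shift[OF this] this show ?thesis using walk[OF m(2)] by simp
    qed
    have "r x y z = ?B (c + 1)" if P: "?P x y z" for x y z
    proof -
      have "tri x y z" using P by (simp add: remove_triangle_def)
      then show ?thesis
      proof (cases rule: tri_cases)
        case (1 i)
        have xyz: "{x, y, z} = {l i, l (i + 1), l (i + 3)}" using 1 by auto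
        have ne: "l i \<noteq> l c"
        proof
          assume ic: "l i = l c"
          have "{x, y, z} = {l c, l (c + 1), l (c + 3)}"
            unfolding xyz ic label_shift[OF ic] ..
          then show False using P by (simp add: remove_triangle_def)
        qed
        note u = up[OF ne]
        have A: "?A i = ?B (c + 1)" by (rule trans[OF AB[OF ne] B])
        note A' = trans[OF rot[OF u] A] and A'' = trans[OF rot[OF rotP[OF u]] trans[OF rot[OF u] A]]
        from 1 consider "x = l i" "y = l (i + 1)" "z = l (i + 3)" | "x = l (i + 1)" "y = l (i + 3)" "z = l i"
          | "x = l (i + 3)" "y = l i" "z = l (i + 1)" by blast
        then show ?thesis by cases (simp_all only: A A' A'')
      next
        case (2 i)
        note d = down[of i]
        note B' = trans[OF rot[OF d] B] and B'' = trans[OF rot[OF rotP[OF d]] trans[OF rot[OF d] B]]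
        from 2 consider "x = l i" "y = l (i + 3)" "z = l (i + 2)" | "x = l (i + 3)" "y = l (i + 2)" "z = l i"
          | "x = l (i + 2)" "y = l i" "z = l (i + 3)" by blast
        then show ?thesis by cases (simp_all only: B[of i] B' B'')
      qed
    qed
    then show "\<exists>k. \<forall>x y z. ?P x y z \<longrightarrow> r x y z = k" by blast
  qed
qed

lemma oriented_pseudomanifold_tri: "oriented_pseudomanifold tri"
proof
  have "range l \<subseteq> l ` {0..<n}"
  proof
    fix v assume "v \<in> range l"
    then obtain i where "v = l i" by blast
    then show "v \<in> l ` {0..<n}" using label_mod[of i] n7 by (intro image_eqI[of _ _ "i mod n"]) auto
  qed
  then have fin: "finite (range l)" by (rule finite_subset) simp
  have "{s. \<exists>x y z. tri x y z \<and> s = {x, y, z}} \<subseteq> Pow (range l)"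
    unfolding tri_def by blast
  then show "finite {s. \<exists>x y z. tri x y z \<and> s = {x, y, z}}"
    by (rule finite_subset) (use fin in simp)
  show "tri y z x" if "tri x y z" for x y z using tri_rotate[OF that] .
  show "z = z'" if t1: "tri x y z" and t2: "tri x y z'" for x y z z'
  proof -
    obtain i j0 k0 where "(j0, k0) \<in> link_offsets"
      and i: "x = l i" and "y = l (i + j0)" "z = l (i + k0)"
      by (rule triE[OF t1])
    obtain j k where 1: "(j, k) \<in> link_offsets" "y = l (i + j)" "z = l (i + k)"
      by (rule tri_base[OF t1[unfolded i]])
    obtain j' k' where 2: "(j', k') \<in> link_offsets" "y = l (i + j')" "z' = l (i + k')"
      by (rule tri_base[OF t2[unfolded i]])
    have "\<bar>j - j'\<bar> < 7" using 1(1) 2(1) by auto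
    then have "j = j'" using 1(2) 2(2) label_offset_eq_iff by blast
    then have "k = k'" using 1(1) 2(1) by auto
    then show ?thesis using 1(3) 2(3) by simp
  qed
  show opposite: "\<exists>w. tri y x w" if t: "tri x y z" for x y z
  proof -
    obtain i j k where jk: "(j, k) \<in> link_offsets"
      and xy: "x = l i" "y = l (i + j)" and "z = l (i + k)"
      by (rule triE[OF t])
    have "\<exists>k'. (- j, k') \<in> link_offsets"
      using jk by auto
    then obtain k' where "(- j, k') \<in> link_offsets" ..
    from tri_at[OF this, of "i + j"] show ?thesis unfolding xy by auto
  qed
  show asym: "\<not> tri y x z" if t: "tri x y z" for x y z
  proof
    assume yxz: "tri y x z"
    obtain i j0 k0 where jk: "(j0, k0) \<in> link_offsets"
      and xy: "x = l i" "y = l (i + j0)" and "z = l (i + k0)"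
      by (rule triE[OF t])
    have j0: "\<bar>j0\<bar> \<le> 3" using jk by auto
    obtain k k' where k: "(j0, k) \<in> link_offsets" "z = l (i + k)"
      "(- j0, k') \<in> link_offsets" "z = l (i + j0 + k')"
    proof (rule tri_opposite_offsets[of i j0 z z])
      show "tri (l i) (l (i + j0)) z" "tri (l (i + j0)) (l i) z" using t yxz unfolding xy .
    qed (rule j0, rule that)
    have "\<bar>k - (j0 + k')\<bar> < 7" using k(1,3) by auto
    then have "k = j0 + k'"
      using k(2,4) label_offset_eq_iff[of k "j0 + k'" i] by (simp add: add.assoc)
    then show False using k(1,3) by auto
  qed
  show "\<exists>x y z. tri x y z" using tri_upward by blast
  show "edge_connected tri"
    unfolding edge_connected_def
  proof (intro allI impI)
    fix r :: "nat \<Rightarrow> nat \<Rightarrow> nat \<Rightarrow> int"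
    let ?s = "{l 0, l (0 + 1), l (0 + 3)}"
    assume "\<forall>x y z. tri x y z \<longrightarrow> r y z x = r x y z"
      and "\<forall>x y z w. tri x y z \<longrightarrow> tri y x w \<longrightarrow> r x y z = r y x w"
    then have rot: "\<And>x y z. tri x y z \<Longrightarrow> r y z x = r x y z"
      and cross: "\<And>x y z w. tri x y z \<Longrightarrow> tri y x w \<Longrightarrow> r x y z = r y x w" by blast+
    obtain k where k: "\<And>x y z. remove_triangle ?s tri x y z \<Longrightarrow> r x y z = k"
    proof (rule edge_connectedD[OF edge_connected_remove[of 0], of r])
      show "r y z x = r x y z" if "remove_triangle ?s tri x y z" for x y z
        by (rule rot) (use that in \<open>simp add: remove_triangle_def\<close>)
      show "r x y z = r y x w" if "remove_triangle ?s tri x y z" "remove_triangle ?s tri y x w" for x y z w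
        by (rule cross) (use that in \<open>simp_all add: remove_triangle_def\<close>)
    qed (rule that)
    have "r x y z = k" if xyz: "tri x y z" for x y z
    proof (cases "{x, y, z} = ?s")
      case False
      then show ?thesis using k xyz by (simp add: remove_triangle_def)
    next
      case True
      obtain w where w: "tri y x w" using opposite[OF xyz] by blast
      have "w \<noteq> z" using asym[OF xyz] w by blast
      moreover have "tri x w y" "tri w y x" using w tri_rotate by blast+
      then have "w \<noteq> x" "w \<noteq> y" using asym w by blast+
      ultimately have "{y, x, w} \<noteq> {x, y, z}" by auto
      then show ?thesis using k[of y x w] w cross[OF xyz w] True by (simp add: remove_triangle_def)
    qed
    then show "\<exists>k. \<forall>x y z. tri x y z \<longrightarrow> r x y z = k" by blast
  qed
qed

end

section \<open>Simplicial maps to the 7-vertex torus\<close>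

text \<open>Labels start at 1, as in the 7-vertex torus, whose label \<open>i\<close> is then the vertex
  \<open>i\<close> for \<open>i\<close> from 1 to 7.\<close>

definition cyclic_label :: "int \<Rightarrow> int \<Rightarrow> nat" where
  "cyclic_label n i = Suc (nat ((i - 1) mod n))"

text \<open>The second torus meets the first, with vertices 1 to \<open>n\<close>, in 2, 3 and 5 only. The
  labels 2 and 3 are interchanged so that the common triangle has opposite orientations on the two
  sides.\<close>

definition seam_label :: "int \<Rightarrow> int \<Rightarrow> nat" where
  "seam_label n i = (let j = i mod 7 in
     if j = 2 then 3 else if j = 3 then 2 else if j = 5 then 5 else nat (n + 1 + j))"

definition reduce_label :: "int \<Rightarrow> nat \<Rightarrow> nat" where
  "reduce_label n v = (if int v \<le> n then Suc ((v - 1) mod 7) else 2)"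

lemma cyclic_labelling_cyclic_label:
  assumes "7 \<le> n"
  shows "cyclic_labelling n (cyclic_label n)"
proof
  show "7 \<le> n" by fact
  fix i j :: int
  have "cyclic_label n i = cyclic_label n j \<longleftrightarrow> (i - 1) mod n = (j - 1) mod n"
    using assms by (simp add: cyclic_label_def nat_eq_iff)
  then show "cyclic_label n i = cyclic_label n j \<longleftrightarrow> i mod n = j mod n"
    by (simp add: mod_eq_dvd_iff)
qed

lemma cyclic_label_le:
  assumes "7 \<le> n"
  shows "int (cyclic_label n i) \<le> n"
proof -
  have "0 \<le> (i - 1) mod n" "(i - 1) mod n < n" using assms by simp_all
  then show ?thesis unfolding cyclic_label_def by linarith
qed

lemma cyclic_labelling_seam_label:
  assumes "7 \<le> n"
  shows "cyclic_labelling 7 (seam_label n)"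
proof
  fix i j :: int
  define r s where "r = i mod 7" and "s = j mod 7"
  have "0 \<le> r" "0 \<le> s" by (simp_all add: r_def s_def)
  then have "0 \<le> n + 1 + r" "0 \<le> n + 1 + s" "nat (n + 1 + r) > 5" "nat (n + 1 + s) > 5" using assms by linarith+
  then show "seam_label n i = seam_label n j \<longleftrightarrow> i mod 7 = j mod 7"
    unfolding seam_label_def Let_def r_def[symmetric] s_def[symmetric]
    by (auto simp: eq_nat_nat_iff)
qed simp

lemma seam_label_range: "7 \<le> n \<Longrightarrow> seam_label n i \<in> {2, 3, 5} \<or> n < int (seam_label n i)"
  by (auto simp: seam_label_def Let_def)

lemma reduce_cyclic_label:
  assumes "0 < d"
  shows "reduce_label (7 * d) (cyclic_label (7 * d) i) = cyclic_label 7 i"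
proof -
  have "nat ((i - 1) mod (7 * d)) mod 7 = nat ((i - 1) mod (7 * d) mod 7)"
    using assms by (simp add: nat_mod_distrib)
  also have "(i - 1) mod (7 * d) mod 7 = (i - 1) mod 7"
    by (simp add: mod_mod_cancel)
  finally show ?thesis
    using cyclic_label_le[of "7 * d" i] assms by (simp add: reduce_label_def cyclic_label_def)
qed

lemma cyclic_label_eq_iff: "Suc k \<le> 7 \<Longrightarrow> cyclic_label 7 i = Suc k \<longleftrightarrow> (i - 1) mod 7 = int k"
  by (auto simp: cyclic_label_def nat_eq_iff)

lemma reduce_seam_label: "7 \<le> n \<Longrightarrow> reduce_label n (seam_label n i) \<in> {2, 3, 5}"
  using seam_label_range[of n i] by (auto simp: reduce_label_def)

text \<open>The 14 listed triangles are exactly the 7 translates of \<open>{1, 2, 4}\<close> and the 7 translates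
  of \<open>{1, 3, 4}\<close>.\<close>

lemma torus7_translates:
  "{cyclic_label 7 i, cyclic_label 7 (i + 1), cyclic_label 7 (i + 3)} \<in> torus7"
  "{cyclic_label 7 i, cyclic_label 7 (i + 2), cyclic_label 7 (i + 3)} \<in> torus7"
proof -
  define r where "r = (i - 1) mod 7"
  have lab: "cyclic_label 7 (i + s) = Suc (nat ((r + s) mod 7))" for s
  proof -
    have "(r + s) mod 7 = (i - 1 + s) mod 7" unfolding r_def by (rule mod_add_left_eq)
    also have "i - 1 + s = i + s - 1" by simp
    finally show ?thesis unfolding cyclic_label_def by simp
  qed
  have "0 \<le> r" "r < 7" by (simp_all add: r_def)
  then have r: "r = 0 \<or> r = 1 \<or> r = 2 \<or> r = 3 \<or> r = 4 \<or> r = 5 \<or> r = 6" by linarith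
  have lab0: "cyclic_label 7 i = Suc (nat (r mod 7))" using lab[of 0] by simp
  have mem: "{u, v, w} \<in> torus7 \<longleftrightarrow> (\<exists>t\<in>torus7_triangles. u \<in> t \<and> v \<in> t \<and> w \<in> t)" for u v w
    by (simp add: torus7_def)
  show "{cyclic_label 7 i, cyclic_label 7 (i + 1), cyclic_label 7 (i + 3)} \<in> torus7"
    unfolding mem lab lab0 using r by (elim disjE) (simp_all add: torus7_triangles_def)
  show "{cyclic_label 7 i, cyclic_label 7 (i + 2), cyclic_label 7 (i + 3)} \<in> torus7"
    unfolding mem lab lab0 using r by (elim disjE) (simp_all add: torus7_triangles_def)
qed

lemma torus7_face: "t \<in> torus7 \<Longrightarrow> s \<subseteq> t \<Longrightarrow> s \<noteq> {} \<Longrightarrow> s \<in> torus7"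
  unfolding torus7_def by blast

lemma finite_vertices_torus7: "finite (vertices torus7)"
proof (rule finite_subset)
  show "vertices torus7 \<subseteq> vertices torus7_triangles" unfolding torus7_def by blast
  show "finite (vertices torus7_triangles)" by (simp add: torus7_triangles_def)
qed

lemma card_torus7_le_3: "s \<in> torus7 \<Longrightarrow> card s \<le> 3"
proof -
  assume "s \<in> torus7"
  then obtain t where t: "t \<in> torus7_triangles" "s \<subseteq> t" unfolding torus7_def by blast
  have "\<forall>t\<in>torus7_triangles. finite t \<and> card t = 3" by (simp add: torus7_triangles_def)
  then show ?thesis using t card_mono by metis
qed

text \<open>The push-forward is a cycle, hence a multiple of the orientation \<open>b\<close>, and \<open>b\<close>
  is normalised to 1 on \<open>[1, 2, 4]\<close>.\<close>

lemma degree_eq_push_chain: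
  assumes b: "torus7_orientation b" and K: "finite (vertices K)"
    and a: "fundamental_cycle K a" and f: "simplicial_map K torus7 f"
  shows "has_degree K a torus7 b f (push_chain K f a [1, 2, 4])"
proof -
  have "push_chain K f a \<in> cycles 2 torus7"
    using a unfolding fundamental_cycle_def
    by (intro push_chain_cycle[OF K finite_vertices_torus7 f]) blast
  then obtain k where "homologous 2 torus7 (push_chain K f a) (\<lambda>ys. k * b ys)"
    using b unfolding torus7_orientation_def fundamental_cycle_def by blast
  then have k: "push_chain K f a = (\<lambda>ys. k * b ys)"
    using homologous_2_iff_eq[of torus7] card_torus7_le_3 by blast
  moreover have "b [1, 2, 4] = 1" using b unfolding torus7_orientation_def by blast
  ultimately have "push_chain K f a [1, 2, 4] = k" by simp
  then show ?thesis
    unfolding has_degree_def using homologous_2_iff_eq[of torus7] card_torus7_le_3 k by blast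
qed

text \<open>Numbers of vertices are well-ordered.\<close>

lemma minimal_degree_map_exists:
  assumes "degree_map_to_torus7 g b d K a f"
  shows "\<exists>K a f. minimal_degree_map_to_torus7 g b d K a f"
proof -
  let ?P = "\<lambda>(K, a, f). degree_map_to_torus7 g b d K a f"
  have "?P (K, a, f)" using assms by simp
  from ex_has_least_nat[of ?P, OF this, of "\<lambda>(K, a, f). card (vertices K)"]
  show ?thesis unfolding minimal_degree_map_to_torus7_def by (auto simp: split_paired_all)
qed

text \<open>The orientation of the domain may be reversed, which changes the sign of the degree.\<close>

lemma degree_maps_of_both_signs:
  assumes "torus7_orientation b" "finite (vertices K)" "triangulated_genus_surface g K"
    "fundamental_cycle K a" "simplicial_map K torus7 f" "push_chain K f a [1, 2, 4] = d"
  shows "degree_map_to_torus7 g b d K a f" "degree_map_to_torus7 g b (- d) K (\<lambda>xs. - a xs) f"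
proof -
  show "degree_map_to_torus7 g b d K a f"
    unfolding degree_map_to_torus7_def
    using assms(3-5) degree_eq_push_chain[OF assms(1,2,4,5)] assms(6) by simp
  have a': "fundamental_cycle K (\<lambda>xs. - a xs)" by (rule fundamental_cycle_uminus[OF assms(4)])
  show "degree_map_to_torus7 g b (- d) K (\<lambda>xs. - a xs) f"
    unfolding degree_map_to_torus7_def
    using assms(3,5) a' degree_eq_push_chain[OF assms(1,2) a' assms(5)] assms(6)
    by (simp add: push_chain_uminus)
qed

context
  fixes n :: int
  assumes n7: "7 \<le> n"
begin

interpretation C: cyclic_labelling n "cyclic_label n"
  by (rule cyclic_labelling_cyclic_label[OF n7])

interpretation S: cyclic_labelling 7 "seam_label n"
  by (rule cyclic_labelling_seam_label[OF n7])

lemma seam_labels: "cyclic_label n 2 = 2" "cyclic_label n 3 = 3" "cyclic_label n 5 = 5"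
  "seam_label n 2 = 3" "seam_label n 3 = 2" "seam_label n 5 = 5"
  using n7 by (simp_all add: cyclic_label_def seam_label_def mod_pos_pos_trivial)

lemma triangle_gluing_cyclic: "triangle_gluing C.tri S.tri 2 3 5"
proof -
  interpret PC: oriented_pseudomanifold C.tri by (rule C.oriented_pseudomanifold_tri)
  interpret PS: oriented_pseudomanifold S.tri by (rule S.oriented_pseudomanifold_tri)
  show ?thesis
  proof
    show "C.tri 2 3 5" using C.tri_upward[of 2] by (simp add: seam_labels)
    show "S.tri 3 2 5" using S.tri_upward[of 2] by (simp add: seam_labels)
    show "vertices (triangle_complex C.tri) \<inter> vertices (triangle_complex S.tri) \<subseteq> {2, 3, 5}"
    proof
      fix v assume v: "v \<in> vertices (triangle_complex C.tri) \<inter> vertices (triangle_complex S.tri)"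
      then obtain s t where "v \<in> s" "s \<in> triangle_complex C.tri" "v \<in> t" "t \<in> triangle_complex S.tri" by blast
      then have "v \<in> range (cyclic_label n)" "v \<in> range (seam_label n)"
        unfolding C.tri_complex_iff S.tri_complex_iff by blast+
      then obtain i j where "v = cyclic_label n i" "v = seam_label n j" by blast
      then show "v \<in> {2, 3, 5}"
        using cyclic_label_le[OF n7, of i] seam_label_range[OF n7, of j] by auto
    qed
    show "edge_connected (remove_triangle {2, 3, 5} C.tri)"
      using C.edge_connected_remove[of 2] by (simp add: seam_labels)
    have "{3, 2, 5} = {2, 3, 5::nat}" by blast
    then show "edge_connected (remove_triangle {2, 3, 5} S.tri)"
      using S.edge_connected_remove[of 2] by (simp add: seam_labels)
  qed
qed

lemma triangulated_torus: "triangulated_genus_surface 1 (triangle_complex C.tri)"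
  "triangulated_genus_surface 1 (triangle_complex S.tri)"
  using C.carrier_homeomorphic_torus S.carrier_homeomorphic_torus
    oriented_pseudomanifold.complex[OF C.oriented_pseudomanifold_tri] oriented_pseudomanifold.complex[OF S.oriented_pseudomanifold_tri]
  by (simp_all add: triangulated_genus_surface_def)

end

lemma cyclic_label_block:
  assumes "0 < d" "s < 7"
  shows "cyclic_label (7 * d) (7 * t + 1 + int s) = 7 * nat (t mod d) + 1 + s"
proof -
  have m: "0 \<le> t mod d" "t mod d < d" using assms by simp_all
  have "(7 * t + int s) mod (7 * d) = 7 * (t mod d) + int s"
  proof (rule int_mod_pos_eq)
    have "t = d * (t div d) + t mod d" by simp
    then have "7 * t = 7 * d * (t div d) + 7 * (t mod d)" by (metis distrib_left mult.assoc)
    then show "7 * t + int s = 7 * d * (t div d) + (7 * (t mod d) + int s)" by simp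
    show "0 \<le> 7 * (t mod d) + int s" using m by simp
    show "7 * (t mod d) + int s < 7 * d" using m assms by linarith
  qed
  then have "cyclic_label (7 * d) (7 * t + 1 + int s) = Suc (nat (7 * (t mod d) + int s))"
    unfolding cyclic_label_def by (simp add: algebra_simps)
  also have "\<dots> = 7 * nat (t mod d) + 1 + s" using m by (simp add: nat_add_distrib nat_mult_distrib)
  finally show ?thesis .
qed

context
  fixes d n :: int
  assumes d: "0 < d" and n: "n = 7 * d"
begin

interpretation C: cyclic_labelling n "cyclic_label n"
  by (rule cyclic_labelling_cyclic_label) (use d n in simp)

interpretation S: cyclic_labelling 7 "seam_label n"
  by (rule cyclic_labelling_seam_label) (use d n in simp)

interpretation G: triangle_gluing C.tri S.tri 2 3 5
  by (rule triangle_gluing_cyclic) (use d n in simp)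

lemma reduce_label_eq: "reduce_label n (cyclic_label n i) = Suc k \<longleftrightarrow> (i - 1) mod 7 = int k" if "Suc k \<le> 7" for k
  using reduce_cyclic_label[OF d] cyclic_label_eq_iff[OF that] unfolding n by simp

text \<open>Reduction modulo 7 preserves offsets, and 1, 2, 4 have offsets 0, 1, 3 from the first vertex. So
  the triangles over \<open>[1, 2, 4]\<close> are the upward ones at the labels congruent to 1 modulo
  7, one in each block of seven.\<close>

lemma triangles_over_124:
  "{(x, y, z). C.tri x y z \<and> reduce_label n x = 1 \<and> reduce_label n y = 2 \<and> reduce_label n z = 4}
    = (\<lambda>k. (7 * k + 1, 7 * k + 2, 7 * k + 4)) ` {..<nat d}" (is "?A = ?B")
proof (rule set_eqI, rule iffI)
  fix p assume "p \<in> ?A"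
  then obtain x y z where p: "p = (x, y, z)" and t: "C.tri x y z"
    and f: "reduce_label n x = 1" "reduce_label n y = 2" by blast
  obtain i j k where jk: "(j, k) \<in> link_offsets"
    and xyz: "x = cyclic_label n i" "y = cyclic_label n (i + j)" "z = cyclic_label n (i + k)"
    by (rule C.triE[OF t])
  have i: "(i - 1) mod 7 = 0" and j: "(i + j - 1) mod 7 = 1"
    using f reduce_label_eq[of 0] reduce_label_eq[of 1] unfolding xyz by (simp_all add: numeral_2_eq_2)
  obtain m where m: "i = 7 * m + 1"
    using i by (metis add.commute diff_add_cancel mult.commute mod_0_imp_dvd dvdE)
  have "j mod 7 = 1" using j unfolding m by (simp add: mod_add_left_eq)
  then have "j = 1" "k = 3" using jk by auto
  then have "p = (7 * nat (m mod d) + 1, 7 * nat (m mod d) + 2, 7 * nat (m mod d) + 4)"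
    unfolding p xyz m n
    using cyclic_label_block[OF d, of 0 m] cyclic_label_block[OF d, of 1 m] cyclic_label_block[OF d, of 3 m]
    by simp
  moreover have "nat (m mod d) \<in> {..<nat d}" using d by (simp add: nat_less_eq_zless)
  ultimately show "p \<in> ?B" by blast
next
  fix p assume "p \<in> ?B"
  then obtain k where k: "k < nat d" and p: "p = (7 * k + 1, 7 * k + 2, 7 * k + 4)" by blast
  let ?i = "7 * int k + 1"
  have kd: "nat (int k mod d) = k" using k by simp
  have xyz: "cyclic_label n ?i = 7 * k + 1" "cyclic_label n (?i + 1) = 7 * k + 2" "cyclic_label n (?i + 3) = 7 * k + 4"
    using cyclic_label_block[OF d, of 0 "int k"] cyclic_label_block[OF d, of 1 "int k"]
      cyclic_label_block[OF d, of 3 "int k"] unfolding kd n by simp_all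
  have "reduce_label n (cyclic_label n ?i) = Suc 0" "reduce_label n (cyclic_label n (?i + 1)) = Suc 1"
    "reduce_label n (cyclic_label n (?i + 3)) = Suc 3"
    by (subst reduce_label_eq; simp)+
  then show "p \<in> ?A" using C.tri_upward[of ?i] unfolding xyz p by simp
qed

text \<open>The offset from 2 to 1 is \<open>-1\<close>, and on that side of the edge the third offset is
  \<open>-3\<close>, which leads to 6 and not to 4.\<close>

lemma no_reversed_triangles_over_124:
  assumes t: "C.tri y x z" and f: "reduce_label n x = 1" "reduce_label n y = 2" "reduce_label n z = 4"
  shows False
proof -
  obtain i j k where jk: "(j, k) \<in> link_offsets"
    and xyz: "y = cyclic_label n i" "x = cyclic_label n (i + j)" "z = cyclic_label n (i + k)"
    by (rule C.triE[OF t])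
  have "(i - 1) mod 7 = 1" and j: "(i + j - 1) mod 7 = 0" and k: "(i + k - 1) mod 7 = 3"
    using f reduce_label_eq[of 0] reduce_label_eq[of 1] reduce_label_eq[of 3] unfolding xyz
    by (simp_all add: numeral_2_eq_2 numeral_eq_Suc)
  then obtain m where m: "i - 1 = 7 * m + 1"
    by (metis mult_div_mod_eq)
  have "(1 + j) mod 7 = (i + j - 1) mod 7" "(1 + k) mod 7 = (i + k - 1) mod 7"
    using m mod_mult_self4[of 7 m "1 + j"] mod_mult_self4[of 7 m "1 + k"] by (simp_all add: algebra_simps)
  then show False using jk j k by auto
qed

lemma push_cyclic: "push_chain (triangle_complex C.tri) (reduce_label n) (orientation_chain C.tri) [1, 2, 4] = d"
proof -
  have "inj_on (\<lambda>k. (7 * k + 1, 7 * k + 2, 7 * k + 4)) {..<nat d}" by (rule inj_onI) simp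
  then have fwd: "card {(x, y, z). C.tri x y z \<and> reduce_label n x = 1 \<and> reduce_label n y = 2 \<and> reduce_label n z = 4} = nat d"
    unfolding triangles_over_124 by (simp add: card_image)
  have bwd: "{(x, y, z). C.tri y x z \<and> reduce_label n x = 1 \<and> reduce_label n y = 2 \<and> reduce_label n z = 4} = {}"
    using no_reversed_triangles_over_124 by blast
  show ?thesis
    unfolding G.P.push_orientation_chain fwd bwd using d by simp
qed

lemma reduce_label_seam: "S.tri x y z \<Longrightarrow> reduce_label n x \<noteq> 1 \<and> reduce_label n y \<noteq> 1"
proof -
  assume t: "S.tri x y z"
  obtain i j where "x = seam_label n i" "y = seam_label n j" by (rule S.triE[OF t])
  then show ?thesis using reduce_seam_label[of n i] reduce_seam_label[of n j] d n by auto
qed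

text \<open>Neither the seam nor the second torus has a vertex over 1.\<close>

lemma glue_over_124:
  assumes "reduce_label n x = 1 \<or> reduce_label n y = 1"
  shows "glue {2, 3, 5} C.tri S.tri x y z \<longleftrightarrow> C.tri x y z"
proof -
  have "reduce_label n v \<noteq> 1" if "v \<in> {2, 3, 5}" for v
    using that d n by (auto simp: reduce_label_def)
  then have "{x, y, z} \<noteq> {2, 3, 5}" using assms by (metis insertI1 insert_commute)
  then show ?thesis
    using assms reduce_label_seam[of x y z] unfolding glue_def remove_triangle_def by blast
qed

lemma push_glue:
  "push_chain (triangle_complex (glue {2, 3, 5} C.tri S.tri)) (reduce_label n)
     (orientation_chain (glue {2, 3, 5} C.tri S.tri)) [1, 2, 4] = d"
proof -
  have eq: "{(x, y, z). glue {2, 3, 5} C.tri S.tri x y z \<and> reduce_label n x = 1 \<and> reduce_label n y = 2 \<and> reduce_label n z = 4}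
    = {(x, y, z). C.tri x y z \<and> reduce_label n x = 1 \<and> reduce_label n y = 2 \<and> reduce_label n z = 4}"
    "{(x, y, z). glue {2, 3, 5} C.tri S.tri y x z \<and> reduce_label n x = 1 \<and> reduce_label n y = 2 \<and> reduce_label n z = 4}
    = {(x, y, z). C.tri y x z \<and> reduce_label n x = 1 \<and> reduce_label n y = 2 \<and> reduce_label n z = 4}"
    using glue_over_124 by auto
  show ?thesis
    unfolding oriented_pseudomanifold.push_orientation_chain[OF G.oriented_pseudomanifold_glue] eq
      G.P.push_orientation_chain[symmetric] by (rule push_cyclic)
qed

lemma simplicial_map_cyclic: "simplicial_map (triangle_complex C.tri) torus7 (reduce_label n)"
  unfolding simplicial_map_def
proof
  fix s assume s: "s \<in> triangle_complex C.tri"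
  have red: "reduce_label n (cyclic_label n i) = cyclic_label 7 i" for i
    using reduce_cyclic_label[OF d] unfolding n .
  obtain i where "s \<noteq> {}" and "s \<subseteq> {cyclic_label n i, cyclic_label n (i + 1), cyclic_label n (i + 3)} \<or>
      s \<subseteq> {cyclic_label n i, cyclic_label n (i + 2), cyclic_label n (i + 3)}"
    using s unfolding C.tri_complex_iff by blast
  then have "reduce_label n ` s \<subseteq> {cyclic_label 7 i, cyclic_label 7 (i + 1), cyclic_label 7 (i + 3)} \<or>
      reduce_label n ` s \<subseteq> {cyclic_label 7 i, cyclic_label 7 (i + 2), cyclic_label 7 (i + 3)}"
    using red by auto
  then show "reduce_label n ` s \<in> torus7"
    using torus7_face torus7_translates \<open>s \<noteq> {}\<close> by (metis image_is_empty)
qed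

lemma simplicial_map_glue:
  "simplicial_map (triangle_complex (glue {2, 3, 5} C.tri S.tri)) torus7 (reduce_label n)"
  unfolding simplicial_map_def G.triangle_complex_glue
proof
  fix s assume s: "s \<in> triangle_complex C.tri \<union> triangle_complex S.tri - {{2, 3, 5}}"
  show "reduce_label n ` s \<in> torus7"
  proof (cases "s \<in> triangle_complex C.tri")
    case True
    then show ?thesis using simplicial_map_cyclic unfolding simplicial_map_def by blast
  next
    case False
    then have S: "s \<in> triangle_complex S.tri" using s by blast
    then have "s \<subseteq> range (seam_label n)" "s \<noteq> {}" unfolding S.tri_complex_iff by blast+
    then have "reduce_label n ` s \<subseteq> {2, 3, 5}"
      using reduce_seam_label[of n] d n by auto
    moreover have "{2, 3, 5} \<in> torus7" unfolding torus7_def torus7_triangles_def by blast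
    ultimately show ?thesis using torus7_face \<open>s \<noteq> {}\<close> by (metis image_is_empty)
  qed
qed

end

lemma exists_surface_map_nonneg:
  assumes g: "g = 1 \<or> g = 2" and d: "0 \<le> d"
  shows "\<exists>(P :: nat \<Rightarrow> nat \<Rightarrow> nat \<Rightarrow> bool) f. oriented_pseudomanifold P \<and> triangulated_genus_surface g (triangle_complex P) \<and>
    simplicial_map (triangle_complex P) torus7 f \<and>
    push_chain (triangle_complex P) f (orientation_chain P) [1, 2, 4] = d"
proof -
  have pos: "\<exists>(P :: nat \<Rightarrow> nat \<Rightarrow> nat \<Rightarrow> bool) f. oriented_pseudomanifold P \<and> triangulated_genus_surface g (triangle_complex P) \<and>
      simplicial_map (triangle_complex P) torus7 f \<and>
      push_chain (triangle_complex P) f (orientation_chain P) [1, 2, 4] = d" if d: "0 < d" for d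
  proof -
    let ?n = "7 * d"
    have n7: "7 \<le> ?n" using d by simp
    interpret C: cyclic_labelling ?n "cyclic_label ?n" by (rule cyclic_labelling_cyclic_label[OF n7])
    interpret S: cyclic_labelling 7 "seam_label ?n" by (rule cyclic_labelling_seam_label[OF n7])
    have G: "triangle_gluing C.tri S.tri 2 3 5" by (rule triangle_gluing_cyclic[OF n7])
    from g show ?thesis
    proof
      assume g: "g = 1"
      show ?thesis
        unfolding g
        by (intro exI conjI)
          (rule C.oriented_pseudomanifold_tri triangulated_torus(1)[OF n7]
            simplicial_map_cyclic[OF d refl] push_cyclic[OF d refl])+
    next
      assume g: "g = 2"
      show ?thesis
        unfolding g
        by (intro exI conjI)
          (rule triangle_gluing.oriented_pseudomanifold_glue[OF G]
            triangulated_genus_2_glue[OF G triangulated_torus[OF n7]]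
            simplicial_map_glue[OF d refl] push_glue[OF d refl])+
    qed
  qed
  show ?thesis
  proof (cases "d = 0")
    case False
    then show ?thesis using pos d by simp
  next
    case True
    \<comment> \<open>A constant map has degree 0, whatever surface of the right genus it lives on.\<close>
    obtain P :: "nat \<Rightarrow> nat \<Rightarrow> nat \<Rightarrow> bool" where P: "oriented_pseudomanifold P" "triangulated_genus_surface g (triangle_complex P)"
      using pos[OF zero_less_one] by blast
    have "{1} \<in> torus7" by (simp add: torus7_def torus7_triangles_def)
    moreover have "s \<noteq> {}" if "s \<in> triangle_complex P" for s
      using that unfolding triangle_complex_def by blast
    ultimately have map: "simplicial_map (triangle_complex P) torus7 (\<lambda>_. 1 :: nat)"
      unfolding simplicial_map_def by (simp add: image_constant_conv)
    have push: "push_chain (triangle_complex P) (\<lambda>_. 1 :: nat) (orientation_chain P) [1, 2, 4] = d"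
      unfolding oriented_pseudomanifold.push_orientation_chain[OF P(1)] True by simp
    show ?thesis by (intro exI conjI) (rule P map push)+
  qed
qed

lemma degree_map_exists:
  assumes b: "torus7_orientation b" and g: "g = 1 \<or> g = 2"
  shows "\<exists>K a f. degree_map_to_torus7 g b d K a f"
proof -
  obtain P :: "nat \<Rightarrow> nat \<Rightarrow> nat \<Rightarrow> bool" and f where P: "oriented_pseudomanifold P" "triangulated_genus_surface g (triangle_complex P)"
    "simplicial_map (triangle_complex P) torus7 f"
    "push_chain (triangle_complex P) f (orientation_chain P) [1, 2, 4] = \<bar>d\<bar>"
    using exists_surface_map_nonneg[OF g abs_ge_zero[of d]] by blast
  note both_signs = degree_maps_of_both_signs[OF b oriented_pseudomanifold.finite_vertices[OF P(1)] P(2)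
      oriented_pseudomanifold.fundamental[OF P(1)] P(3,4)]
  show ?thesis
  proof (cases "0 \<le> d")
    case True
    then have "\<bar>d\<bar> = d" by simp
    then show ?thesis using both_signs(1) by metis
  next
    case False
    then have "- \<bar>d\<bar> = d" by simp
    then show ?thesis using both_signs(2) by metis
  qed
qed

theorem corollary9:
  fixes b :: "nat list \<Rightarrow> int"
  assumes "torus7_orientation b"
  shows "\<forall>d::int.
           (\<exists>K a f. minimal_degree_map_to_torus7 1 b d K a f) \<and>
           (\<exists>K a f. minimal_degree_map_to_torus7 2 b d K a f)"
proof (intro allI conjI)
  fix d
  have "\<exists>K a f. minimal_degree_map_to_torus7 g b d K a f" if g: "g = 1 \<or> g = 2" for g
  proof -
    obtain K a f where "degree_map_to_torus7 g b d K a f"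
      using degree_map_exists[OF assms g] by blast
    then show ?thesis by (rule minimal_degree_map_exists)
  qed
  then show "\<exists>K a f. minimal_degree_map_to_torus7 1 b d K a f"
    "\<exists>K a f. minimal_degree_map_to_torus7 2 b d K a f" by simp_all
qed

end
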